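(* Consider a directed network system $\dot x(t)=-\mathcal{L}x(t)+Fu(t)$, $y(t)=Hx(t)$ on a weakly connected weighted digraph with Laplacian matrix $\mathcal{L}\in\mathbb{R}^{n\times n}$, and let $\mathcal{P}$ and $\mathcal{Q}$ be its pseudo controllability and observability Gramians. The dissimilarity between two clusterable vertices $i$ and $j$ is computed as $$\mathcal{D}_{ij}=\sqrt{\mathbf e_{ij}^\top\mathcal{P}\mathbf e_{ij}\;\mathbf e_{ij}^\top M^{-1}\mathcal{Q}M^{-1}\mathbf e_{ij}},$$ where $\mathbf e_{ij}=\mathbf e_i-\mathbf e_j$.
   Context: Digraphs: $\mathcal{G}=(\mathbb{V},\mathbb{E})$ with $\mathbb{V}=\{1,\dots,n\}$; an edge $(i,j)\in\mathbb{E}$ means that information flows from vertex $j$ to vertex $i$ and has weight $w_{ij}>0$; $w_{ij}=0$ if $(i,j)\notin\mathbb{E}$. The Laplacian is $\mathcal{L}=\mathrm{diag}(\mathcal{W}\mathbf{1})-\mathcal{W}$, $\mathcal{W}=[w_{ij}]$. $\mathcal{G}$ is weakly connected if there is an undirected path between any two vertices. A strongly connected component (SCC) is a maximal strongly connected subgraph; a leading SCC (LSCC) is an SCC that has only outflows (no edge brings information into it from outside). A weakly connected weighted digraph is generalized balanced if each LSCC $\mathcal{S}_k$ satisfies $\sum_{j\in\mathcal{S}_k}w_{ij}=\sum_{j\in\mathcal{S}_k}w_{ji}$ for all $i\in\mathcal{S}_k$. There is a positive diagonal matrix $M$ such that $L:=M\mathcal{L}$ is the Laplacian matrix of a generalized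 balanced digraph; fix such $M$ and $L$. Let $\mathbf e_i$ be the $i$-th column of $I_n$. Vertices $i$ and $j$ are clusterable if $\mathbf e_{ij}\in\ker(L)^\perp$ and $\mathbf e_{ij}\in\ker(L^\top)^\perp$. The dissimilarity of a pair of clusterable vertices is $\mathcal{D}_{ij}=\mathcal{D}^I_{ij}\cdot\mathcal{D}^O_{ij}$ with $$\mathcal{D}^I_{ij}=\|(\mathbf e_i-\mathbf e_j)^\top(sM+L)^{-1}MF\|_{\mathcal{H}_2},\qquad \mathcal{D}^O_{ij}=\|H(sM+L)^{-1}(\mathbf e_i-\mathbf e_j)\|_{\mathcal{H}_2}.$$ With $\mathcal{J}:=\lim_{\tau\to\infty}e^{-\mathcal{L}\tau}$ (which exists, the system being semistable), the pseudo Gramians of the network system are $$\mathcal{P}=\int_0^\infty(e^{-\mathcal{L}\tau}-\mathcal{J})FF^\top(e^{-\mathcal{L}^\top\tau}-\mathcal{J}^\top)\,d\tau,\qquad \mathcal{Q}=\int_0^\infty(e^{-\mathcal{L}^\top\tau}-\mathcal{J}^\top)H^\top H(e^{-\mathcal{L}\tau}-\mathcal{J})\,d\tau .$$ *)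

theory Defs
  imports "Graph_Theory.Digraph_Component" "HOL-Analysis.Analysis"
begin

section \<open>Weighted digraphs and their Laplacians\<close>

text \<open>
  A weighted digraph on the vertex set \<open>'n\<close> is given by its weight matrix, the edges being the pairs
  of positive weight. The edge \<open>(i, j)\<close> carries information from \<open>j\<close> to \<open>i\<close>, so its tail is \<open>j\<close> and
  its head is \<open>i\<close>. Self-loops are not excluded; they cancel in the Laplacian and in the balance
  condition.
\<close>

definition weighted_digraph :: "real^'n^'n \<Rightarrow> bool" where
  "weighted_digraph W \<longleftrightarrow> (\<forall>i j. 0 \<le> W $ i $ j)"

definition digraph_of :: "real^'n^'n \<Rightarrow> ('n, 'n \<times> 'n) pre_digraph" where
  "digraph_of W = \<lparr>verts = UNIV, arcs = {(i, j). 0 < W $ i $ j}, tail = snd, head = fst\<rparr>"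

definition weakly_connected :: "real^'n^'n \<Rightarrow> bool" where
  "weakly_connected W \<longleftrightarrow> Digraph_Component.connected (digraph_of W)"

definition lsccs :: "real^'n^'n \<Rightarrow> ('n, 'n \<times> 'n) pre_digraph set" where
  "lsccs W = {S \<in> pre_digraph.sccs (digraph_of W).
     \<not> (\<exists>e \<in> arcs (digraph_of W).
          head (digraph_of W) e \<in> verts S \<and> tail (digraph_of W) e \<notin> verts S)}"

definition generalized_balanced :: "real^'n^'n \<Rightarrow> bool" where
  "generalized_balanced W \<longleftrightarrow> weighted_digraph W \<and> weakly_connected W \<and>
     (\<forall>S \<in> lsccs W. \<forall>i \<in> verts S. (\<Sum>j \<in> verts S. W $ i $ j) = (\<Sum>j \<in> verts S. W $ j $ i))"

definition diag_matrix :: "'a::zero^'n \<Rightarrow> 'a^'n^'n" where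
  "diag_matrix v = (\<chi> i j. if i = j then v $ i else 0)"

definition laplacian :: "real^'n^'n \<Rightarrow> real^'n^'n" where
  "laplacian W = diag_matrix (W *v 1) - W"

definition positive_diagonal :: "real^'n^'n \<Rightarrow> bool" where
  "positive_diagonal M \<longleftrightarrow> (\<exists>m. (\<forall>i. 0 < m $ i) \<and> M = diag_matrix m)"

section \<open>Clusterable vertices\<close>

definition e_diff :: "'n \<Rightarrow> 'n \<Rightarrow> 'a::ring_1^'n" where
  "e_diff i j = axis i 1 - axis j 1"

definition clusterable :: "real^'n^'n \<Rightarrow> 'n \<Rightarrow> 'n \<Rightarrow> bool" where
  "clusterable L i j \<longleftrightarrow>
     e_diff i j \<in> {x. L *v x = 0}\<^sup>\<bottom> \<and> e_diff i j \<in> {x. transpose L *v x = 0}\<^sup>\<bottom>"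

section \<open>The H2 norm and the dissimilarity\<close>

text \<open>
  The squared norm in the Hardy space of the open right half-plane; on matrices \<^const>\<open>norm\<close> is the
  Frobenius norm, so the integrand is the trace of \<open>G(s)\<^sup>* G(s)\<close>. The supremum over vertical lines in
  the open half-plane avoids evaluating at the pole of \<open>(sM + L)\<^sup>-\<^sup>1\<close> at the origin, which cancels
  only in the products considered below.
\<close>

definition h2_norm_sq :: "(complex \<Rightarrow> complex^'p^'q) \<Rightarrow> ennreal" where
  "h2_norm_sq G = (SUP \<sigma> \<in> {0<..}.
     ennreal (1 / (2 * pi)) * (\<integral>\<^sup>+ \<omega>. ennreal ((norm (G (Complex \<sigma> \<omega>)))\<^sup>2) \<partial>lborel))"

text \<open>Meaningful only when \<open>h2_norm_sq G\<close> is finite.\<close>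

definition h2_norm :: "(complex \<Rightarrow> complex^'p^'q) \<Rightarrow> real" where
  "h2_norm G = sqrt (enn2real (h2_norm_sq G))"

abbreviation cmat :: "real^'n^'m \<Rightarrow> complex^'n^'m" where
  "cmat A \<equiv> map_matrix complex_of_real A"

definition resolvent :: "real^'n^'n \<Rightarrow> real^'n^'n \<Rightarrow> complex \<Rightarrow> complex^'n^'n" where
  "resolvent M L s = matrix_inv (mat s ** cmat M + cmat L)"

definition input_transfer ::
    "real^'n^'n \<Rightarrow> real^'n^'n \<Rightarrow> real^'p^'n \<Rightarrow> 'n \<Rightarrow> 'n \<Rightarrow> complex \<Rightarrow> complex^'p^1" where
  "input_transfer M L F i j s = rowvector (e_diff i j) ** resolvent M L s ** cmat M ** cmat F"

definition output_transfer ::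
    "real^'n^'n \<Rightarrow> real^'n^'n \<Rightarrow> real^'n^'q \<Rightarrow> 'n \<Rightarrow> 'n \<Rightarrow> complex \<Rightarrow> complex^1^'q" where
  "output_transfer M L H i j s = cmat H ** resolvent M L s ** columnvector (e_diff i j)"

definition dissimilarity ::
    "real^'n^'n \<Rightarrow> real^'n^'n \<Rightarrow> real^'p^'n \<Rightarrow> real^'n^'q \<Rightarrow> 'n \<Rightarrow> 'n \<Rightarrow> real" where
  "dissimilarity M L F H i j =
     h2_norm (input_transfer M L F i j) * h2_norm (output_transfer M L H i j)"

section \<open>Pseudo Gramians\<close>

definition matrix_exp :: "real^'n^'n \<Rightarrow> real^'n^'n" where
  "matrix_exp A = (\<Sum>k. inverse (fact k) *\<^sub>R ((**) A ^^ k) (mat 1))"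

definition semistable_limit :: "real^'n^'n \<Rightarrow> real^'n^'n" where
  "semistable_limit A = Lim at_top (\<lambda>\<tau>. matrix_exp (- \<tau> *\<^sub>R A))"

text \<open>In the following, \<open>A\<close> is the Laplacian of the system \<open>x' = - A x + F u\<close>, \<open>y = H x\<close>.\<close>

definition ctrl_integrand :: "real^'n^'n \<Rightarrow> real^'p^'n \<Rightarrow> real \<Rightarrow> real^'n^'n" where
  "ctrl_integrand A F \<tau> =
     (matrix_exp (- \<tau> *\<^sub>R A) - semistable_limit A) ** F ** transpose F **
     (matrix_exp (- \<tau> *\<^sub>R transpose A) - transpose (semistable_limit A))"

definition obs_integrand :: "real^'n^'n \<Rightarrow> real^'n^'q \<Rightarrow> real \<Rightarrow> real^'n^'n" where
  "obs_integrand A H \<tau> =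
     (matrix_exp (- \<tau> *\<^sub>R transpose A) - transpose (semistable_limit A)) ** transpose H ** H **
     (matrix_exp (- \<tau> *\<^sub>R A) - semistable_limit A)"

definition ctrl_gramian :: "real^'n^'n \<Rightarrow> real^'p^'n \<Rightarrow> real^'n^'n" where
  "ctrl_gramian A F = integral {0..} (ctrl_integrand A F)"

definition obs_gramian :: "real^'n^'n \<Rightarrow> real^'n^'q \<Rightarrow> real^'n^'n" where
  "obs_gramian A H = integral {0..} (obs_integrand A H)"

end

theory Submission
  imports Defs "HOL-Probability.Sinc_Integral" "HOL-Real_Asymp.Real_Asymp"
begin

text \<open>
  Write \<open>A\<close> for the Laplacian and \<open>E(t) = e\<^sup>-\<^sup>A\<^sup>t\<close>. Since \<open>A = c (1 - S)\<close> with \<open>S\<close> stochastic, \<open>E(t)\<close> is a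
  Poisson average of the powers of \<open>S\<close>, and the Poisson variance gives \<open>A E(t) = O(t\<^sup>-\<^sup>1\<^sup>/\<^sup>2)\<close>. On the
  range of \<open>A\<close> the semigroup is therefore a contraction at some time, so \<open>A E(t)\<close> decays exponentially
  and \<open>E(t)\<close> converges exponentially to some \<open>J\<close> with \<open>A J = J A = 0\<close>.

  The resolvent \<open>(s + A)\<^sup>-\<^sup>1\<close> is the Laplace transform of \<open>E\<close>, so both transfer functions are Laplace
  transforms of \<open>e\<^sup>T E(t) F\<close> and \<open>H E(t) M\<^sup>-\<^sup>1 e\<close>. Clusterability says \<open>e\<^sup>T J = 0\<close> and \<open>J M\<^sup>-\<^sup>1 e = 0\<close>, so
  \<open>E(t)\<close> may be replaced by \<open>E(t) - J\<close>, and Plancherel's theorem turns the H2 norms into the quadratic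
  forms of the pseudo Gramians. Plancherel's theorem itself is proved by Abel summation of the
  frequency integral.
\<close>

text \<open>The Laplacian always has the eigenvalue 0, so \<open>E(t)\<close> itself does not decay
  and \<open>(sM + L)^{-1}\<close> has a pole at the origin. Hence the transfer functions are
  evaluated on lines \<open>Re s = r\<close> with \<open>r > 0\<close>, where the Laplace integral
  of a merely bounded function converges; the limit \<open>r -> 0\<close> is taken only afterwards,
  in the time domain, by monotone convergence. The Poisson estimate takes the place of a spectral
  argument for the semisimplicity of the eigenvalue 0 and the location of the others: it uses only
  that the entries of all powers of a stochastic matrix are bounded by 1.\<close>

lemma norm_matrix_mult_le:
  fixes A :: "real^'n^'m" and B :: "real^'p^'n"
  shows "norm (A ** B) \<le> norm A * norm B"
proof -
  have row: "norm ((A ** B) $ i) \<le> norm (A $ i) * norm B" for i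
  proof -
    \<comment> \<open>A row of the product is a combination of the rows of \<open>B\<close>, so
      Cauchy-Schwarz bounds it; \<open>norm\<close> on matrices is the Frobenius norm.\<close>
    have "(A ** B) $ i = (\<Sum>k\<in>UNIV. A $ i $ k *\<^sub>R B $ k)"
      by (simp add: matrix_matrix_mult_def vec_eq_iff)
    then have "norm ((A ** B) $ i) \<le> (\<Sum>k\<in>UNIV. \<bar>A $ i $ k\<bar> * norm (B $ k))"
      by (metis (no_types, lifting) norm_scaleR norm_sum sum.cong)
    also have "\<dots> = (\<Sum>k\<in>UNIV. \<bar>A $ i $ k\<bar> * \<bar>norm (B $ k)\<bar>)"
      by simp
    also have "\<dots> \<le> L2_set (\<lambda>k. A $ i $ k) UNIV * L2_set (\<lambda>k. norm (B $ k)) UNIV"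
      by (rule L2_set_mult_ineq)
    also have "\<dots> = norm (A $ i) * norm B"
      by (simp add: norm_vec_def[of B] norm_vec_def[of "A $ i"] L2_set_def)
    finally show ?thesis .
  qed
  have "norm (A ** B) = L2_set (\<lambda>i. norm ((A ** B) $ i)) UNIV"
    by (simp add: norm_vec_def)
  also have "\<dots> \<le> L2_set (\<lambda>i. norm (A $ i) * norm B) UNIV"
    by (rule L2_set_mono) (use row in auto)
  also have "\<dots> = norm A * norm B"
    by (simp add: L2_set_left_distrib[symmetric] norm_vec_def[of A])
  finally show ?thesis .
qed

lemma bounded_bilinear_matrix_mult:
  "bounded_bilinear ((**) :: real^'n^'m \<Rightarrow> real^'p^'n \<Rightarrow> real^'p^'m)"
proof
  show "\<exists>K. \<forall>A B. norm (A ** B :: real^'p^'m) \<le> norm (A :: real^'n^'m) * norm (B :: real^'p^'n) * K"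
    by (rule exI[of _ 1]) (simp add: norm_matrix_mult_le)
qed (auto simp: matrix_matrix_mult_def vec_eq_iff algebra_simps sum.distrib sum_distrib_left)

text \<open>Puts the product rule, limits, continuity and linearity of the matrix product under the
  prefix \<open>matrix_mult\<close>, for rectangular shapes as well, since \<open>F\<close> and
  \<open>H\<close> are rectangular.\<close>

interpretation matrix_mult: bounded_bilinear "(**) :: real^'n^'m \<Rightarrow> real^'p^'n \<Rightarrow> real^'p^'m"
  by (rule bounded_bilinear_matrix_mult)

lemma has_vector_derivative_matrix:
  fixes X :: "real \<Rightarrow> real^'n^'m"
  assumes "\<And>i j. ((\<lambda>t. X t $ i $ j) has_real_derivative D $ i $ j) (at t)"
  shows "(X has_vector_derivative D) (at t)"
  unfolding has_vector_derivative_def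
proof (subst has_derivative_componentwise_within, rule ballI)
  fix b :: "real^'n^'m" assume "b \<in> Basis"
  then obtain i j where b: "b = axis i (axis j 1)"
    by (auto simp: Basis_vec_def)
  show "((\<lambda>x. X x \<bullet> b) has_derivative (\<lambda>x. (x *\<^sub>R D) \<bullet> b)) (at t)"
    using assms[of i j] unfolding has_field_derivative_def b
    by (simp add: inner_axis mult.commute[of _ "D $ i $ j"])
qed

lemma bounded_linear_matrix_component: "bounded_linear (\<lambda>A::real^'n^'m. A $ i $ j)"
  using bounded_linear_compose[OF bounded_linear_vec_nth bounded_linear_vec_nth] by blast

lemma has_vector_derivative_matrix_component:
  fixes X :: "real \<Rightarrow> real^'n^'m"
  assumes "(X has_vector_derivative D) F"
  shows "((\<lambda>t. X t $ i $ j) has_real_derivative D $ i $ j) F"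
  using bounded_linear.has_vector_derivative[OF bounded_linear_matrix_component assms]
  by (simp add: has_real_derivative_iff_has_vector_derivative)

section \<open>The matrix exponential\<close>

abbreviation mpow :: "real^'n^'n \<Rightarrow> nat \<Rightarrow> real^'n^'n" where
  "mpow A k \<equiv> ((**) A ^^ k) (mat 1)"

lemma mpow_commute: "A ** mpow A k = mpow A k ** A"
proof (induction k)
  case (Suc k)
  have "A ** mpow A (Suc k) = A ** (mpow A k ** A)"
    using Suc by simp
  also have "\<dots> = mpow A (Suc k) ** A"
    by (simp add: matrix_mul_assoc)
  finally show ?case .
qed simp

lemma mpow_scaleR: "mpow (c *\<^sub>R A) k = c ^ k *\<^sub>R mpow A k"
  by (induction k) (auto simp: matrix_mult.scaleR_left matrix_mult.scaleR_right)

lemma mpow_transpose: "mpow (transpose A) k = transpose (mpow A k)"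
proof (induction k)
  case (Suc k)
  have "mpow (transpose A) (Suc k) = transpose (mpow A k ** A)"
    using Suc by (simp add: matrix_transpose_mul)
  then show ?case by (simp add: mpow_commute)
qed simp

lemma norm_mpow_le: "norm (mpow A k) \<le> norm (mat 1 :: real^'n^'n) * norm (A :: real^'n^'n) ^ k"
proof (induction k)
  case (Suc k)
  have "norm (mpow A (Suc k)) \<le> norm A * norm (mpow A k)"
    by (simp add: norm_matrix_mult_le)
  also have "\<dots> \<le> norm A * (norm (mat 1 :: real^'n^'n) * norm A ^ k)"
    by (intro mult_left_mono Suc) auto
  finally show ?case by (simp add: mult_ac)
qed simp

lemma matrix_exp_sums:
  "(\<lambda>k. inverse (fact k) *\<^sub>R mpow A k) sums matrix_exp (A :: real^'n^'n)"
proof -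
  have "summable (\<lambda>k. norm (mat 1 :: real^'n^'n) * (inverse (fact k) * norm A ^ k))"
    by (intro summable_mult summable_exp)
  then have "summable (\<lambda>k. inverse (fact k) *\<^sub>R mpow A k)"
  proof (rule summable_comparison_test')
    fix k
    have "norm (inverse (fact k) *\<^sub>R mpow A k) = inverse (fact k) * norm (mpow A k)"
      by simp
    also have "\<dots> \<le> inverse (fact k) * (norm (mat 1 :: real^'n^'n) * norm A ^ k)"
      by (intro mult_left_mono norm_mpow_le) auto
    finally show "norm (inverse (fact k) *\<^sub>R mpow A k)
        \<le> norm (mat 1 :: real^'n^'n) * (inverse (fact k) * norm A ^ k)"
      by (simp add: mult_ac)
  qed
  then show ?thesis
    unfolding matrix_exp_def by (rule summable_sums)
qed

lemma matrix_exp_component_sums: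
  "(\<lambda>k. inverse (fact k) * mpow A k $ i $ j * t ^ k) sums (matrix_exp (t *\<^sub>R A) $ i $ j)"
  using bounded_linear.sums[OF bounded_linear_matrix_component matrix_exp_sums, of "t *\<^sub>R A" i j]
  by (simp add: mpow_scaleR mult_ac)

lemma matrix_exp_zero [simp]: "matrix_exp 0 = (mat 1 :: real^'n^'n)"
proof -
  have "inverse (fact k) *\<^sub>R mpow 0 k = (if k = 0 then mat 1 else 0 :: real^'n^'n)" for k
    by (cases k) (auto simp: matrix_mult.zero_left)
  then have "(\<lambda>k. if k = 0 then mat 1 else 0) sums matrix_exp (0 :: real^'n^'n)"
    using matrix_exp_sums[of "0 :: real^'n^'n"] by presburger
  from sums_unique2[OF this sums_single] show ?thesis by simp
qed

lemma transpose_scaleR: "transpose (c *\<^sub>R A) = c *\<^sub>R transpose (A :: real^'n^'m)"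
  by (simp add: transpose_def vec_eq_iff)

lemma matrix_exp_transpose: "matrix_exp (transpose A) = transpose (matrix_exp A)"
proof -
  have "bounded_linear (transpose :: real^'n^'n \<Rightarrow> real^'n^'n)"
    by (intro linear_conv_bounded_linear[THEN iffD1] linearI) (auto simp: transpose_def vec_eq_iff)
  from bounded_linear.sums[OF this matrix_exp_sums, of A]
  have "(\<lambda>k. inverse (fact k) *\<^sub>R mpow (transpose A) k) sums transpose (matrix_exp A)"
    by (simp only: mpow_transpose transpose_scaleR)
  from sums_unique2[OF matrix_exp_sums this] show ?thesis .
qed

text \<open>Every entry is an everywhere convergent real power series in \<open>t\<close> and may be
  differentiated termwise; the factor \<open>Suc k\<close> cancels against
  \<open>fact (Suc k)\<close>, which leaves one extra \<open>A\<close> in front of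
  \<open>mpow A k\<close>.\<close>

lemma matrix_exp_has_vector_derivative:
  "((\<lambda>t. matrix_exp (t *\<^sub>R A)) has_vector_derivative A ** matrix_exp (t *\<^sub>R A)) (at t)"
proof (rule has_vector_derivative_matrix)
  fix i j
  define c where "c = (\<lambda>k. inverse (fact k) * mpow A k $ i $ j)"
  have sm: "summable (\<lambda>k. c k * x ^ k)" for x
    unfolding c_def using matrix_exp_component_sums by (blast dest: sums_summable)
  have f: "matrix_exp (x *\<^sub>R A) $ i $ j = (\<Sum>k. c k * x ^ k)" for x
    unfolding c_def using matrix_exp_component_sums by (blast dest: sums_unique)
  have "diffs c k * t ^ k = (\<Sum>l\<in>UNIV. A $ i $ l * (inverse (fact k) * mpow A k $ l $ j * t ^ k))" for k
  proof -
    have "diffs c k = inverse (fact k) * mpow A (Suc k) $ i $ j"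
      unfolding diffs_def c_def
      by (simp add: field_simps del: funpow.simps of_nat_Suc)
    also have "mpow A (Suc k) $ i $ j = (\<Sum>l\<in>UNIV. A $ i $ l * mpow A k $ l $ j)"
      by (simp add: matrix_matrix_mult_def)
    finally show ?thesis by (simp add: sum_distrib_left sum_distrib_right mult_ac)
  qed
  then have "(\<lambda>k. diffs c k * t ^ k) sums (A ** matrix_exp (t *\<^sub>R A)) $ i $ j"
    by (simp add: matrix_matrix_mult_def) (intro sums_sum sums_mult matrix_exp_component_sums)
  then show "((\<lambda>t. matrix_exp (t *\<^sub>R A) $ i $ j) has_real_derivative
      (A ** matrix_exp (t *\<^sub>R A)) $ i $ j) (at t)"
    using termdiffs_strong_converges_everywhere[OF sm, of t] by (simp add: f sums_iff)
qed

lemma matrix_exp_commute: "A ** matrix_exp (t *\<^sub>R A) = matrix_exp (t *\<^sub>R A) ** A"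
proof -
  have "(\<lambda>k. A ** (inverse (fact k) *\<^sub>R mpow (t *\<^sub>R A) k)) sums (A ** matrix_exp (t *\<^sub>R A))"
    by (rule bounded_linear.sums[OF matrix_mult.bounded_linear_right matrix_exp_sums])
  moreover have "(\<lambda>k. (inverse (fact k) *\<^sub>R mpow (t *\<^sub>R A) k) ** A) sums (matrix_exp (t *\<^sub>R A) ** A)"
    by (rule bounded_linear.sums[OF matrix_mult.bounded_linear_left matrix_exp_sums])
  moreover have "A ** (inverse (fact k) *\<^sub>R mpow (t *\<^sub>R A) k) = (inverse (fact k) *\<^sub>R mpow (t *\<^sub>R A) k) ** A" for k
    by (simp add: mpow_scaleR matrix_mult.scaleR_left matrix_mult.scaleR_right mpow_commute)
  ultimately show ?thesis by (simp add: sums_unique2)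
qed

lemma matrix_exp_minus_has_vector_derivative:
  "((\<lambda>t. matrix_exp (- t *\<^sub>R A)) has_vector_derivative - (A ** matrix_exp (- t *\<^sub>R A))) (at t)"
  using matrix_exp_has_vector_derivative[of "- A" t] by (simp add: matrix_mult.minus_left)

text \<open>The product has derivative 0, since \<open>B\<close> commutes with its exponential.
  Suitable choices of \<open>X\<close> yield both the inverse of the exponential and uniqueness for
  \<open>X' = B X\<close>, so no Cauchy product of series is formed.\<close>

lemma matrix_exp_minus_mult_ode:
  assumes "\<And>t. (X has_vector_derivative B ** X t) (at t)"
  shows "matrix_exp (- t *\<^sub>R B) ** X t = X 0"
proof -
  have "((\<lambda>t. matrix_exp (- t *\<^sub>R B) ** X t) has_vector_derivative 0) (at t within UNIV)" for t
    using matrix_mult.has_vector_derivative[OF matrix_exp_minus_has_vector_derivative[where A = B and t = t] assms[of t]]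
    using matrix_exp_commute[of B "-t"]
    by (simp add: matrix_mul_assoc matrix_mult.minus_left)
  from has_vector_derivative_zero_constant[OF convex_UNIV this]
  obtain c where c: "\<And>t. matrix_exp (- t *\<^sub>R B) ** X t = c" by auto
  from c[of t] c[of 0] show ?thesis by simp
qed

lemma matrix_exp_minus_mult: "matrix_exp (- t *\<^sub>R B) ** matrix_exp (t *\<^sub>R B) = mat 1"
  using matrix_exp_minus_mult_ode[OF matrix_exp_has_vector_derivative, of t B] by simp

lemma linear_ode_unique:
  assumes "\<And>t. (X has_vector_derivative B ** X t) (at t)"
  shows "X t = matrix_exp (t *\<^sub>R B) ** X 0"
proof -
  have "matrix_exp (t *\<^sub>R B) ** matrix_exp (- t *\<^sub>R B) = mat 1"
    by (rule matrix_left_right_inverse1[OF matrix_exp_minus_mult])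
  then have "X t = (matrix_exp (t *\<^sub>R B) ** matrix_exp (- t *\<^sub>R B)) ** X t"
    by simp
  also have "\<dots> = matrix_exp (t *\<^sub>R B) ** X 0"
    unfolding matrix_exp_minus_mult_ode[OF assms, of t, symmetric] by (rule matrix_mul_assoc[symmetric])
  finally show ?thesis .
qed

text \<open>Both sides, as functions of \<open>s\<close>, solve \<open>X' = B X\<close> with the
  value \<open>matrix_exp (t *\<^sub>R B)\<close> at 0.\<close>

lemma matrix_exp_add: "matrix_exp ((s + t) *\<^sub>R B) = matrix_exp (s *\<^sub>R B) ** matrix_exp (t *\<^sub>R B)"
proof -
  have "((\<lambda>s. matrix_exp ((s + t) *\<^sub>R B)) has_vector_derivative B ** matrix_exp ((s + t) *\<^sub>R B)) (at s)" for s
  proof -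
    have "((\<lambda>s. s + t) has_vector_derivative 1) (at s)"
      by (auto intro!: derivative_eq_intros simp: has_real_derivative_iff_has_vector_derivative[symmetric])
    from vector_diff_chain_at[OF this matrix_exp_has_vector_derivative[where A = B and t = "s + t"]]
    show ?thesis by (simp add: o_def)
  qed
  from linear_ode_unique[OF this, of s] show ?thesis by simp
qed

section \<open>Exponential semistability\<close>

definition poisson :: "real \<Rightarrow> nat \<Rightarrow> real" where
  "poisson x k = exp (- x) * x ^ k / fact k"

lemma poisson_nonneg: "0 \<le> x \<Longrightarrow> 0 \<le> poisson x k"
  by (simp add: poisson_def)

text \<open>The Poisson weights satisfy \<open>(k + 1) p(k + 1) = x p(k)\<close>; in probabilistic
  terms, \<open>E[N s(N)] = x E[s(N + 1)]\<close>. The index 0 drops out because of the factor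
  \<open>real k\<close>.\<close>

lemma poisson_sums_shift:
  assumes "(\<lambda>k. poisson x k * s (Suc k)) sums a"
  shows "(\<lambda>k. poisson x k * (real k * s k)) sums (x * a)"
proof -
  have "poisson x (Suc k) * (real (Suc k) * s (Suc k)) = x * (poisson x k * s (Suc k))" for k
    by (simp add: poisson_def divide_simps del: of_nat_Suc)
  then have "(\<lambda>k. poisson x (Suc k) * (real (Suc k) * s (Suc k))) sums (x * a)"
    using sums_mult[OF assms, of x] by presburger
  then show ?thesis by (subst (asm) sums_Suc_iff) simp
qed

lemma poisson_sums: "poisson x sums 1"
  using sums_mult[OF exp_converges[of x], of "exp (- x)"]
  by (simp add: poisson_def[abs_def] field_simps exp_minus)

text \<open>Expand \<open>(x - k)\<^sup>2 = x\<^sup>2 - (2 x - 1) k + k (k - 1)\<close>; the shift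
  rule gives the mean from \<open>s k = 1\<close> and the second factorial moment
  \<open>x * x\<close> from \<open>s k = k - 1\<close>.\<close>

lemma poisson_variance_sums: "(\<lambda>k. poisson x k * (x - real k)\<^sup>2) sums x"
proof -
  have 1: "(\<lambda>k. poisson x k * real k) sums x"
    using poisson_sums_shift[of x "\<lambda>_. 1" 1] poisson_sums by simp
  then have 2: "(\<lambda>k. poisson x k * (real k * (real k - 1))) sums (x * x)"
    using poisson_sums_shift[of x "\<lambda>k. real k - 1" x] by simp
  have "(\<lambda>k. x\<^sup>2 * poisson x k - (2 * x - 1) * (poisson x k * real k) + poisson x k * (real k * (real k - 1)))
     sums (x\<^sup>2 * 1 - (2 * x - 1) * x + x * x)"
    by (intro sums_add sums_diff sums_mult poisson_sums 1 2)
  then show ?thesis by (simp add: power2_eq_square algebra_simps)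
qed

text \<open>
  By the shift rule \<open>x (a - b) = \<Sum>k. p k * s k * (x - k)\<close>; now \<open>\<bar>x - k\<bar> \<le> (\<surd>x + (x - k)\<^sup>2 / \<surd>x) / 2\<close>
  and the variance \<open>x\<close> bounds the sum by \<open>\<surd>x\<close>.
\<close>

lemma poisson_difference_bound:
  fixes s :: "nat \<Rightarrow> real"
  assumes x: "0 < x" and s: "\<And>k. \<bar>s k\<bar> \<le> 1"
    and a: "(\<lambda>k. poisson x k * s k) sums a" and b: "(\<lambda>k. poisson x k * s (Suc k)) sums b"
  shows "\<bar>a - b\<bar> \<le> 1 / sqrt x"
proof -
  let ?w = "\<lambda>k. (sqrt x * poisson x k + (1 / sqrt x) * (poisson x k * (x - real k)\<^sup>2)) / 2"
  have "(\<lambda>k. x * (poisson x k * s k) - poisson x k * (real k * s k)) sums (x * a - x * b)"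
    by (intro sums_diff sums_mult poisson_sums_shift a b)
  then have sm: "(\<lambda>k. poisson x k * s k * (x - real k)) sums (x * (a - b))"
    by (simp add: algebra_simps)
  have "?w sums ((sqrt x * 1 + (1 / sqrt x) * x) / 2)"
    by (intro sums_divide sums_add sums_mult poisson_sums poisson_variance_sums)
  moreover have "(1 / sqrt x) * x = sqrt x" using x by (simp add: real_div_sqrt)
  ultimately have w: "?w sums sqrt x" by simp
  have le: "\<bar>poisson x k * s k * (x - real k)\<bar> \<le> ?w k" for k
  proof -
    define r where "r = sqrt x"
    have r: "0 < r" using x by (simp add: r_def)
    have "(r - \<bar>y\<bar>)\<^sup>2 = r * r - 2 * r * \<bar>y\<bar> + y\<^sup>2" for y
      by (simp add: power2_diff) (simp add: power2_eq_square)
    from this[of "x - real k"] have "2 * r * \<bar>x - real k\<bar> \<le> r * r + (x - real k)\<^sup>2"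
      using zero_le_power2[of "r - \<bar>x - real k\<bar>"] by linarith
    then have "2 * r * \<bar>x - real k\<bar> / r \<le> (r * r + (x - real k)\<^sup>2) / r"
      using r by (intro divide_right_mono) auto
    then have "\<bar>x - real k\<bar> \<le> (r + (1 / r) * (x - real k)\<^sup>2) / 2"
      using r by (simp add: add_divide_distrib)
    then have "\<bar>s k\<bar> * \<bar>x - real k\<bar> \<le> 1 * ((r + (1 / r) * (x - real k)\<^sup>2) / 2)"
      by (intro mult_mono s) auto
    then have "poisson x k * (\<bar>s k\<bar> * \<bar>x - real k\<bar>) \<le> poisson x k * ((r + (1 / r) * (x - real k)\<^sup>2) / 2)"
      using poisson_nonneg[of x k] x by (intro mult_left_mono) auto
    also have "\<dots> = ?w k" by (simp add: r_def[symmetric] algebra_simps add_divide_distrib)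
    finally show ?thesis
      using poisson_nonneg[of x k] x by (simp add: abs_mult mult.assoc)
  qed
  have "x * (a - b) \<le> sqrt x"
    by (rule sums_le[OF _ sm w]) (use le abs_le_D1 in blast)
  moreover have "- (x * (a - b)) \<le> sqrt x"
    by (rule sums_le[OF _ sums_minus[OF sm] w]) (use le abs_le_D2 in blast)
  ultimately have "\<bar>x * (a - b)\<bar> \<le> sqrt x" by linarith
  then have "x * \<bar>a - b\<bar> \<le> sqrt x" using x by (simp add: abs_mult)
  then have "\<bar>a - b\<bar> \<le> sqrt x / x" using x by (simp add: field_simps)
  also have "sqrt x / x = 1 / sqrt x" using x by (simp add: field_simps)
  finally show ?thesis .
qed

section \<open>Stochastic matrices and the uniformization of the Laplacian\<close>

definition stochastic :: "real^'n^'n \<Rightarrow> bool" where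
  "stochastic S \<longleftrightarrow> (\<forall>i j. 0 \<le> S $ i $ j) \<and> (\<forall>i. (\<Sum>j\<in>UNIV. S $ i $ j) = 1)"

lemma stochastic_mpow:
  assumes "stochastic S"
  shows "stochastic (mpow S k)"
proof (induction k)
  case 0
  show ?case by (auto simp: stochastic_def mat_def)
next
  case (Suc k)
  have "(\<Sum>j\<in>UNIV. (S ** mpow S k) $ i $ j) = 1" for i
  proof -
    have "(\<Sum>j\<in>UNIV. (S ** mpow S k) $ i $ j) = (\<Sum>l\<in>UNIV. \<Sum>j\<in>UNIV. S $ i $ l * mpow S k $ l $ j)"
      by (simp add: matrix_matrix_mult_def) (rule sum.swap)
    also have "\<dots> = 1"
      using assms Suc by (simp add: stochastic_def sum_distrib_left[symmetric])
    finally show ?thesis .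
  qed
  moreover have "0 \<le> (S ** mpow S k) $ i $ j" for i j
  proof -
    have "0 \<le> (\<Sum>l\<in>UNIV. S $ i $ l * mpow S k $ l $ j)"
      using assms Suc unfolding stochastic_def by (intro sum_nonneg mult_nonneg_nonneg) blast+
    then show ?thesis by (simp add: matrix_matrix_mult_def)
  qed
  ultimately show ?case by (simp add: stochastic_def)
qed

lemma stochastic_component_le:
  assumes "stochastic S"
  shows "\<bar>S $ i $ j\<bar> \<le> 1"
proof -
  have "S $ i $ j \<le> (\<Sum>j\<in>UNIV. S $ i $ j)"
    using assms by (intro member_le_sum) (auto simp: stochastic_def)
  then show ?thesis using assms by (simp add: stochastic_def)
qed

text \<open>The identity part contributes only the scalar \<open>exp (- x)\<close>; with the series
  of \<open>matrix_exp (x *\<^sub>R S)\<close> it forms the weights \<open>poisson x k\<close>. Both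
  sides solve the same linear equation.\<close>

lemma matrix_exp_mat_minus:
  fixes S :: "real^'n^'n"
  shows "matrix_exp (- x *\<^sub>R (mat 1 - S)) = exp (- x) *\<^sub>R matrix_exp (x *\<^sub>R S)"
proof -
  have "((\<lambda>x. exp (- x) *\<^sub>R matrix_exp (x *\<^sub>R S)) has_vector_derivative
      (S - mat 1) ** (exp (- x) *\<^sub>R matrix_exp (x *\<^sub>R S))) (at x)" for x
  proof -
    have "((\<lambda>x. exp (- x)) has_real_derivative - exp (- x)) (at x)"
      by (auto intro!: derivative_eq_intros)
    from has_vector_derivative_scaleR[OF this matrix_exp_has_vector_derivative[where A = S and t = x]]
    show ?thesis
      by (simp add: matrix_mult.diff_left matrix_mult.scaleR_right scaleR_diff_right)
  qed
  from linear_ode_unique[OF this, of x] show ?thesis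
    by (simp add: scaleR_diff_right)
qed

text \<open>Multiplication by \<open>S\<close> replaces \<open>mpow S k\<close> by
  \<open>mpow S (Suc k)\<close>, so each entry is the difference between a Poisson mean and the mean
  of the sequence shifted by one, and the entries of the powers are bounded by 1.\<close>

lemma stochastic_semigroup_bound:
  fixes S :: "real^'n^'n"
  assumes S: "stochastic S" and x: "0 < x"
  shows "\<bar>((mat 1 - S) ** matrix_exp (- x *\<^sub>R (mat 1 - S))) $ i $ j\<bar> \<le> 1 / sqrt x"
proof -
  have E: "(\<lambda>k. poisson x k * mpow S k $ i $ j) sums (matrix_exp (- x *\<^sub>R (mat 1 - S)) $ i $ j)" for i j
    using sums_mult[OF matrix_exp_component_sums, of "exp (- x)" S i j x]
    unfolding matrix_exp_mat_minus by (simp add: poisson_def field_simps)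
  have "(\<lambda>k. \<Sum>l\<in>UNIV. S $ i $ l * (poisson x k * mpow S k $ l $ j)) sums
      (S ** matrix_exp (- x *\<^sub>R (mat 1 - S))) $ i $ j"
    by (simp only: matrix_matrix_mult_def vec_lambda_beta) (intro sums_sum sums_mult E)
  moreover have "(\<Sum>l\<in>UNIV. S $ i $ l * (poisson x k * mpow S k $ l $ j)) = poisson x k * mpow S (Suc k) $ i $ j" for k
    by (simp add: matrix_matrix_mult_def sum_distrib_left mult_ac)
  ultimately have SE: "(\<lambda>k. poisson x k * mpow S (Suc k) $ i $ j) sums
      (S ** matrix_exp (- x *\<^sub>R (mat 1 - S))) $ i $ j"
    by (simp only:)
  show ?thesis
    using poisson_difference_bound[OF x stochastic_component_le[OF stochastic_mpow[OF S]] E SE]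
    by (simp add: matrix_mult.diff_left)
qed

lemma laplacian_component:
  "laplacian W $ i $ j = (if i = j then (\<Sum>k\<in>UNIV. W $ i $ k) else 0) - W $ i $ j"
  by (simp add: laplacian_def diag_matrix_def matrix_vector_mult_def)

lemma laplacian_stochastic:
  fixes W :: "real^'n^'n"
  assumes "weighted_digraph W"
  obtains c S where "0 < c" "stochastic S" "laplacian W = c *\<^sub>R (mat 1 - S)"
proof -
  let ?A = "laplacian W"
  \<comment> \<open>\<open>c\<close> exceeds every diagonal entry of the Laplacian, so that
    \<open>1 - A / c\<close> has a nonnegative diagonal; the summand 1 keeps \<open>c\<close>
    positive when the Laplacian vanishes.\<close>
  define c where "c = 1 + (\<Sum>i\<in>UNIV. \<bar>?A $ i $ i\<bar>)"
  have c: "0 < c" unfolding c_def by (intro add_pos_nonneg sum_nonneg) auto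
  have Aii: "?A $ i $ i \<le> c" for i
    using member_le_sum[of i UNIV "\<lambda>i. \<bar>?A $ i $ i\<bar>"] unfolding c_def by auto
  define S where "S = mat 1 - (1 / c) *\<^sub>R ?A"
  have "0 \<le> S $ i $ j" for i j
  proof (cases "i = j")
    case True
    then show ?thesis using Aii[of i] c by (simp add: S_def mat_def field_simps)
  next
    case False
    then have "S $ i $ j = W $ i $ j / c" by (simp add: S_def mat_def laplacian_component)
    then show ?thesis using c assms by (simp add: weighted_digraph_def)
  qed
  moreover have "(\<Sum>j\<in>UNIV. S $ i $ j) = 1" for i
  proof -
    have "(\<Sum>j\<in>UNIV. S $ i $ j) = (\<Sum>j\<in>UNIV. if i = j then 1 else 0) - (1 / c) * (\<Sum>j\<in>UNIV. ?A $ i $ j)"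
      by (simp add: S_def mat_def sum_subtractf sum_distrib_left sum_divide_distrib)
    also have "(\<Sum>j\<in>UNIV. ?A $ i $ j) = 0"
      by (simp add: laplacian_component sum_subtractf)
    finally show ?thesis by simp
  qed
  ultimately have "stochastic S" by (simp add: stochastic_def)
  moreover have "?A = c *\<^sub>R (mat 1 - S)" using c by (simp add: S_def)
  ultimately show ?thesis using that c by blast
qed

lemma laplacian_semigroup_tendsto_0:
  assumes "weighted_digraph W"
  shows "((\<lambda>t. laplacian W ** matrix_exp (- t *\<^sub>R laplacian W)) \<longlongrightarrow> 0) at_top"
proof -
  obtain c S where c: "0 < c" and S: "stochastic S" and A: "laplacian W = c *\<^sub>R (mat 1 - S)"
    using laplacian_stochastic[OF assms] .
  show ?thesis
  proof (intro vec_tendstoI)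
    fix i j
    have lim: "((\<lambda>t. c * (1 / sqrt (c * t))) \<longlongrightarrow> 0) at_top"
      using c by real_asymp
    show "((\<lambda>t. (laplacian W ** matrix_exp (- t *\<^sub>R laplacian W)) $ i $ j) \<longlongrightarrow> 0 $ i $ j) at_top"
      unfolding zero_index
    proof (rule Lim_null_comparison[OF _ lim])
      show "\<forall>\<^sub>F t in at_top. norm ((laplacian W ** matrix_exp (- t *\<^sub>R laplacian W)) $ i $ j) \<le> c * (1 / sqrt (c * t))"
        using eventually_gt_at_top[of 0]
      proof eventually_elim
        case (elim t)
        \<comment> \<open>The factor \<open>c\<close> is absorbed into the time, whence the bound
          \<open>c / sqrt (c t)\<close>.\<close>
        have t: "- t *\<^sub>R laplacian W = - (c * t) *\<^sub>R (mat 1 - S)" by (simp add: A mult.commute)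
        have "(laplacian W ** matrix_exp (- t *\<^sub>R laplacian W)) $ i $ j =
            c * ((mat 1 - S) ** matrix_exp (- (c * t) *\<^sub>R (mat 1 - S))) $ i $ j"
          unfolding t by (simp add: A matrix_mult.scaleR_left)
        moreover have "c * \<bar>((mat 1 - S) ** matrix_exp (- (c * t) *\<^sub>R (mat 1 - S))) $ i $ j\<bar> \<le> c * (1 / sqrt (c * t))"
          using c elim by (intro mult_left_mono stochastic_semigroup_bound S) auto
        ultimately show ?case using c by (simp add: abs_mult)
      qed
    qed
  qed
qed

section \<open>Exponential decay and convergence of the semigroup\<close>

lemma matrix_generalized_inverse:
  fixes A :: "real^'n^'m"
  obtains X :: "real^'m^'n" where "A ** X ** A = A"
proof -
  obtain g where g: "linear g" "\<And>v. v \<in> range ((*v) A) \<Longrightarrow> A *v g v = v"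
    using linear_exists_right_inverse_on[of "(*v) A" UNIV] by auto
  have "A ** matrix g ** A = A"
    using g by (simp add: matrix_eq matrix_vector_mul_assoc[symmetric] matrix_works)
  then show ?thesis using that by blast
qed

lemma semigroup_exp_decay:
  fixes A :: "real^'n^'n"
  assumes "((\<lambda>t. A ** matrix_exp (- t *\<^sub>R A)) \<longlongrightarrow> 0) at_top"
  obtains K r where "0 < r" "0 \<le> K" "\<And>t. 0 \<le> t \<Longrightarrow> norm (A ** matrix_exp (- t *\<^sub>R A)) \<le> K * exp (- r * t)"
proof -
  let ?E = "\<lambda>t. matrix_exp (- t *\<^sub>R A)"
  have comm: "A ** ?E t = ?E t ** A" for t by (rule matrix_exp_commute)
  have add: "?E (s + t) = ?E s ** ?E t" for s t
    using matrix_exp_add[of "- s" "- t" A] by simp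
  \<comment> \<open>\<open>A\<close> is singular, so \<open>X\<close> stands in for its inverse:
    \<open>A ** X ** A = A\<close> allows \<open>A ** ?E T\<close> to be written as
    \<open>D ** A\<close> with \<open>norm D\<close> at most
    \<open>norm (A ** ?E T) * norm X\<close>.\<close>
  obtain X where X: "A ** X ** A = A" by (rule matrix_generalized_inverse)
  \<comment> \<open>The threshold is chosen to give \<open>norm D \<le> 1 / 2\<close>; adding 1 to
    \<open>norm X\<close> avoids division by zero.\<close>
  have "eventually (\<lambda>t. norm (A ** ?E t) < 1 / (2 * (norm X + 1))) at_top"
  proof -
    have "0 < 1 / (2 * (norm X + 1))" by (simp add: add_nonneg_pos)
    then show ?thesis using tendstoD[OF assms] by (simp add: dist_norm)
  qed
  then have "eventually (\<lambda>t. 0 < t \<and> norm (A ** ?E t) < 1 / (2 * (norm X + 1))) at_top"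
    using eventually_gt_at_top[of 0] by eventually_elim auto
  then obtain T where T: "0 < T" and small: "norm (A ** ?E T) < 1 / (2 * (norm X + 1))"
    using eventually_happens'[OF trivial_limit_at_top_linorder] by blast
  \<comment> \<open>\<open>A E(n T) = D\<^sup>n A\<close>, so smallness of \<open>A E(T)\<close> at a single time forces geometric decay.\<close>
  define D where "D = A ** ?E T ** X"
  have D: "norm D \<le> 1 / 2"
  proof -
    have "norm D \<le> norm (A ** ?E T) * norm X"
      unfolding D_def by (rule norm_matrix_mult_le)
    also have "\<dots> \<le> 1 / (2 * (norm X + 1)) * (norm X + 1)"
      using small by (intro mult_mono) auto
    also have "\<dots> = 1 / 2"
      using norm_ge_zero[of X] by (simp add: field_simps add_nonneg_eq_0_iff)
    finally show ?thesis .
  qed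
  have step: "A ** ?E T = D ** A"
  proof -
    have "D ** A = (?E T ** A) ** X ** A"
      unfolding D_def comm[of T] ..
    also have "\<dots> = ?E T ** (A ** X ** A)"
      by (simp only: matrix_mul_assoc)
    also have "\<dots> = A ** ?E T"
      unfolding X comm[of T] ..
    finally show ?thesis ..
  qed
  have iter: "norm (A ** ?E (real n * T + s)) \<le> (1 / 2) ^ n * norm (A ** ?E s)" for n s
  proof (induction n)
    case (Suc n)
    have "real (Suc n) * T + s = T + (real n * T + s)"
      by (simp add: distrib_right)
    then have "A ** ?E (real (Suc n) * T + s) = (A ** ?E T) ** ?E (real n * T + s)"
      by (simp only: add matrix_mul_assoc)
    also have "\<dots> = D ** (A ** ?E (real n * T + s))"
      unfolding step by (rule matrix_mul_assoc[symmetric])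
    finally have "norm (A ** ?E (real (Suc n) * T + s)) \<le> norm D * norm (A ** ?E (real n * T + s))"
      using norm_matrix_mult_le[of D] by (simp only:)
    also have "\<dots> \<le> (1 / 2) * ((1 / 2) ^ n * norm (A ** ?E s))"
      by (intro mult_mono D Suc) auto
    finally show ?case by simp
  qed simp
  \<comment> \<open>Every \<open>t \<ge> 0\<close> is \<open>n T + s\<close> with \<open>s\<close>
    in \<open>{0..T}\<close>; compactness bounds the contribution of \<open>s\<close>
    uniformly.\<close>
  have cont: "continuous_on {0..T} (\<lambda>t. A ** ?E t)"
    by (intro continuous_at_imp_continuous_on ballI matrix_mult.continuous continuous_const
        has_vector_derivative_continuous[OF matrix_exp_minus_has_vector_derivative])
  then have "compact ((\<lambda>t. A ** ?E t) ` {0..T})"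
    by (rule compact_continuous_image) simp
  then have "bounded ((\<lambda>t. A ** ?E t) ` {0..T})"
    by (rule compact_imp_bounded)
  then obtain B where B: "\<And>s. s \<in> {0..T} \<Longrightarrow> norm (A ** ?E s) \<le> B"
    unfolding bounded_iff by blast
  have "norm (A ** ?E 0) \<le> B" using T by (intro B) auto
  then have B0: "0 \<le> B" using norm_ge_zero order_trans by blast
  \<comment> \<open>\<open>exp (- r * T) = 1 / 2\<close>, so \<open>n = floor (t / T)\<close>
    halvings leave at most \<open>2 * exp (- r * t)\<close>; the 2 pays for rounding down and enters
    the constant \<open>2 * B\<close>.\<close>
  define r where "r = ln 2 / T"
  show thesis
  proof (rule that[of r "2 * B"])
    show "0 < r" using T by (simp add: r_def)
    show "0 \<le> 2 * B" using B0 by simp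
    fix t :: real assume t: "0 \<le> t"
    define n where "n = nat \<lfloor>t / T\<rfloor>"
    have "0 \<le> t / T" using t T by simp
    then have n: "real n \<le> t / T" "t / T < real n + 1"
      unfolding n_def by linarith+
    then have s: "t - real n * T \<in> {0..T}"
      using T by (auto simp: field_simps)
    have "(1 / 2 :: real) ^ n = exp (- ln 2 * real n)"
    proof -
      have "exp (- ln 2 * real n) = exp (- ln 2) ^ n"
        by (metis exp_of_nat_mult mult.commute)
      then show ?thesis by (simp add: exp_minus field_simps)
    qed
    also have "\<dots> \<le> exp (ln 2 - r * t)"
    proof -
      have "ln 2 * (t / T) \<le> ln 2 * (real n + 1)" using n by (intro mult_left_mono) auto
      then show ?thesis by (simp add: r_def algebra_simps)
    qed
    also have "\<dots> = 2 * exp (- r * t)" by (simp add: exp_diff exp_minus field_simps)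
    finally have pw: "(1 / 2 :: real) ^ n \<le> 2 * exp (- r * t)" .
    have "norm (A ** ?E t) \<le> (1 / 2) ^ n * norm (A ** ?E (t - real n * T))"
      using iter[of n "t - real n * T"] by simp
    also have "\<dots> \<le> (2 * exp (- r * t)) * B"
      by (intro mult_mono pw B s) auto
    finally show "norm (A ** ?E t) \<le> 2 * B * exp (- r * t)" by (simp add: mult_ac)
  qed
qed

text \<open>\<open>- K / r * exp (- r * t)\<close> is an antiderivative of the bound on
  \<open>f'\<close>, so by the mean value inequality increments after time \<open>s\<close> are at
  most \<open>K / r * exp (- r * s)\<close>. Letting the later time run to infinity keeps this rate
  for the limit.\<close>

lemma exp_decay_convergent:
  fixes f :: "real \<Rightarrow> 'a::banach"
  assumes r: "0 < r"
    and f: "\<And>t. (f has_vector_derivative f' t) (at t)"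
    and f': "\<And>t. 0 \<le> t \<Longrightarrow> norm (f' t) \<le> K * exp (- r * t)"
  obtains l where "\<And>t. 0 \<le> t \<Longrightarrow> norm (f t - l) \<le> K / r * exp (- r * t)"
proof -
  have K: "0 \<le> K" using order_trans[OF norm_ge_zero f'[of 0]] by simp
  have diff: "norm (f t - f s) \<le> K / r * exp (- r * s)" if "0 \<le> s" "s \<le> t" for s t
  proof (cases "s = t")
    case False
    with that have st: "s < t" by simp
    have "norm (f t - f s) \<le> (- K / r * exp (- r * t)) - (- K / r * exp (- r * s))"
    proof (rule differentiable_bound_general[OF st])
      show "continuous_on {s..t} f"
        using f has_vector_derivative_continuous continuous_at_imp_continuous_on by blast
      show "continuous_on {s..t} (\<lambda>t. - K / r * exp (- r * t))"
        by (intro continuous_intros)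
      show "(f has_vector_derivative f' x) (at x)" for x by (rule f)
      show "((\<lambda>t. - K / r * exp (- r * t)) has_vector_derivative K * exp (- r * x)) (at x)" for x
        using r unfolding has_real_derivative_iff_has_vector_derivative[symmetric]
        by (auto intro!: derivative_eq_intros)
      show "norm (f' x) \<le> K * exp (- r * x)" if "s < x" for x
        using f'[of x] that \<open>0 \<le> s\<close> by simp
    qed
    also have "\<dots> \<le> K / r * exp (- r * s)" using K r by simp
    finally show ?thesis .
  qed (use K r in simp)
  have lim0: "((\<lambda>t. K / r * exp (- r * t)) \<longlongrightarrow> 0) at_top"
    using r by real_asymp
  \<comment> \<open>Integer times suffice to find the limit: \<open>diff\<close> compares them with
    every real \<open>t\<close>.\<close>
  have "Cauchy (\<lambda>n. f (real n))"
  proof (rule metric_CauchyI)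
    fix e :: real assume "0 < e"
    have "(\<lambda>n. K / r * exp (- r * real n)) \<longlonglongrightarrow> 0"
      by (rule filterlim_compose[OF lim0 filterlim_real_sequentially])
    then have "eventually (\<lambda>n. K / r * exp (- r * real n) < e / 2) sequentially"
      using \<open>0 < e\<close> order_tendstoD(2) half_gt_zero by blast
    then obtain N where N: "K / r * exp (- r * real N) < e / 2"
      using eventually_happens sequentially_bot by blast
    have "dist (f (real n)) (f (real N)) < e / 2" if "n \<ge> N" for n
      unfolding dist_norm using that by (intro le_less_trans[OF diff N]) auto
    then show "\<exists>M. \<forall>m\<ge>M. \<forall>n\<ge>M. dist (f (real m)) (f (real n)) < e"
      by (meson dist_triangle_half_l)
  qed
  then obtain l where l: "(\<lambda>n. f (real n)) \<longlonglongrightarrow> l"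
    using Cauchy_convergent convergent_def by blast
  show thesis
  proof (rule that[of l])
    fix t :: real assume t: "0 \<le> t"
    have "(\<lambda>n. norm (f (real n) - f t)) \<longlonglongrightarrow> norm (l - f t)"
      by (intro tendsto_intros l)
    moreover have "\<forall>\<^sub>F n in sequentially. norm (f (real n) - f t) \<le> K / r * exp (- r * t)"
      using eventually_compose_filterlim[OF eventually_ge_at_top filterlim_real_sequentially, of t]
      by (rule eventually_mono) (intro diff t)
    ultimately have "norm (l - f t) \<le> K / r * exp (- r * t)"
      by (rule tendsto_upperbound) simp
    then show "norm (f t - l) \<le> K / r * exp (- r * t)" by (simp add: norm_minus_commute)
  qed
qed

text \<open>\<open>E' = - A E\<close> decays exponentially, which forces \<open>E\<close> to
  converge at the same rate; \<open>A J\<close> and \<open>J A\<close> are the limits of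
  \<open>A E(t)\<close> and \<open>E(t) A\<close>, which coincide and tend to 0.\<close>

lemma laplacian_semistable:
  assumes "weighted_digraph W"
  obtains J C r where "0 < r"
    "\<And>t. 0 \<le> t \<Longrightarrow> norm (matrix_exp (- t *\<^sub>R laplacian W) - J) \<le> C * exp (- r * t)"
    "((\<lambda>t. matrix_exp (- t *\<^sub>R laplacian W)) \<longlongrightarrow> J) at_top"
    "laplacian W ** J = 0" "J ** laplacian W = 0"
proof -
  let ?A = "laplacian W"
  let ?E = "\<lambda>t. matrix_exp (- t *\<^sub>R ?A)"
  note AE0 = laplacian_semigroup_tendsto_0[OF assms]
  obtain K r where r: "0 < r" and K: "0 \<le> K" "\<And>t. 0 \<le> t \<Longrightarrow> norm (?A ** ?E t) \<le> K * exp (- r * t)"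
    using semigroup_exp_decay[OF AE0] by blast
  have "norm (- (?A ** ?E t)) \<le> K * exp (- r * t)" if "0 \<le> t" for t
    using K(2)[OF that] by simp
  from exp_decay_convergent[OF r matrix_exp_minus_has_vector_derivative this]
  obtain J where J: "\<And>t. 0 \<le> t \<Longrightarrow> norm (?E t - J) \<le> K / r * exp (- r * t)" by blast
  have lim: "(?E \<longlongrightarrow> J) at_top"
  proof (rule LIM_zero_cancel, rule Lim_null_comparison)
    show "\<forall>\<^sub>F t in at_top. norm (?E t - J) \<le> K / r * exp (- r * t)"
      using eventually_ge_at_top[of 0] by eventually_elim (rule J)
    show "((\<lambda>t. K / r * exp (- r * t)) \<longlongrightarrow> 0) at_top"
      using r by real_asymp
  qed
  have "?A ** J = 0"
    using tendsto_unique[OF _ matrix_mult.tendsto[OF tendsto_const lim] AE0] by simp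
  moreover have "J ** ?A = 0"
    using tendsto_unique[OF _ matrix_mult.tendsto[OF lim tendsto_const] AE0[unfolded matrix_exp_commute]] by simp
  ultimately show ?thesis using that[OF r J lim] by blast
qed

section \<open>Plancherel's theorem\<close>


text \<open>Interval integrals run over the open half-line, Laplace integrals over
  \<open>{0..}\<close>; the two differ by the null set \<open>{0}\<close>.\<close>

lemma set_integral_FTC_Ici:
  fixes f F :: "real \<Rightarrow> 'a::euclidean_space"
  assumes F: "\<And>x. (F has_vector_derivative f x) (at x)"
    and f: "\<And>x. isCont f x"
    and int: "set_integrable lborel {0..} f"
    and lim: "(F \<longlongrightarrow> B) at_top"
  shows "(LINT x:{0..}|lborel. f x) = B - F 0"
proof -
  have [measurable]: "f \<in> borel_measurable borel"
    using f by (intro borel_measurable_continuous_onI continuous_at_imp_continuous_on) auto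
  have "(LINT x:{0..}|lborel. f x) = (LINT x:{0<..}|lborel. f x)"
    unfolding set_lebesgue_integral_def
  proof (rule integral_cong_AE)
    show "AE x in lborel. indicat_real {0..} x *\<^sub>R f x = indicat_real {0<..} x *\<^sub>R f x"
      using AE_lborel_singleton[of 0] by eventually_elim (auto simp: indicator_def)
  qed measurable
  also have "\<dots> = (LBINT x=0..\<infinity>. f x)"
    by (simp add: interval_lebesgue_integral_0_infty)
  also have "\<dots> = B - F 0"
  proof (rule interval_integral_FTC_integrable)
    have "set_integrable lborel {0<..} f"
      by (rule set_integrable_subset[OF int]) auto
    moreover have "einterval 0 \<infinity> = {0<..}" by (auto simp: einterval_def)
    ultimately show "set_integrable lborel (einterval 0 \<infinity>) f" by simp
    have "isCont F 0" using F has_vector_derivative_continuous by blast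
    then show "((F \<circ> real_of_ereal) \<longlongrightarrow> F 0) (at_right 0)"
      unfolding zero_ereal_def ereal_tendsto_simps isCont_def
      by (rule tendsto_mono[rotated]) (simp add: at_le)
    show "((F \<circ> real_of_ereal) \<longlongrightarrow> B) (at_left \<infinity>)"
      unfolding ereal_tendsto_simps by (rule lim)
  qed (use F f in auto)
  finally show ?thesis .
qed

lemma set_integrable_exp_minus_Ici:
  fixes e :: real
  assumes "0 < e"
  shows "set_integrable lborel {0..} (\<lambda>t. exp (- e * t))"
proof -
  have "(\<lambda>t. exp (- e * t)) absolutely_integrable_on {0..}"
    using assms by (intro nonnegative_absolutely_integrable_1 integrable_on_exp_minus_to_infinity) auto
  then show ?thesis
    unfolding set_integrable_def by (subst (asm) integrable_completion) auto
qed

lemma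
  fixes e u :: real
  assumes "0 < e"
  shows integrable_exp_abs_cos: "integrable lborel (\<lambda>w. exp (- e * \<bar>w\<bar>) * cos (u * w))"
    and integral_exp_abs_cos: "(LINT w|lborel. exp (- e * \<bar>w\<bar>) * cos (u * w)) = 2 * e / (e\<^sup>2 + u\<^sup>2)"
proof -
  \<comment> \<open>\<open>F\<close> is the real part of
    \<open>exp ((- e + i u) w) / (- e + i u)\<close>;
    \<open>- F 0 = e / (e\<^sup>2 + u\<^sup>2)\<close> is half of the integral, and evenness
    supplies the other half.\<close>
  define F where "F = (\<lambda>w. exp (- e * w) * (u * sin (u * w) - e * cos (u * w)) / (e\<^sup>2 + u\<^sup>2))"
  have pos: "e\<^sup>2 + u\<^sup>2 > 0" using assms by (simp add: add_pos_nonneg)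
  have si: "set_integrable lborel {0..} (\<lambda>w. exp (- e * w) * cos (u * w))"
    by (rule set_integrable_bound[OF set_integrable_exp_minus_Ici[OF assms]])
      (auto simp: set_borel_measurable_def abs_mult mult_left_le)
  have e0: "((\<lambda>w. exp (- e * w)) \<longlongrightarrow> 0) at_top"
    using assms
    by (auto intro!: exp_at_bot[THEN filterlim_compose] filterlim_tendsto_pos_mult_at_top filterlim_ident
        simp: filterlim_uminus_at_bot)
  have "(LINT w:{0..}|lborel. exp (- e * w) * cos (u * w)) = 0 - F 0"
  proof (rule set_integral_FTC_Ici[OF _ _ si])
    show "(F has_vector_derivative exp (- e * w) * cos (u * w)) (at w)" for w
    proof -
      have "(F has_real_derivative ((exp (- e * w) * (- e)) * (u * sin (u * w) - e * cos (u * w))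
          + exp (- e * w) * (u * (cos (u * w) * u) - e * (- sin (u * w) * u))) / (e\<^sup>2 + u\<^sup>2)) (at w)"
        unfolding F_def using pos by (auto intro!: derivative_eq_intros)
      also have "((exp (- e * w) * (- e)) * (u * sin (u * w) - e * cos (u * w))
          + exp (- e * w) * (u * (cos (u * w) * u) - e * (- sin (u * w) * u))) =
          (e\<^sup>2 + u\<^sup>2) * (exp (- e * w) * cos (u * w))"
        by (simp add: power2_eq_square algebra_simps)
      finally show ?thesis
        using pos assms by (simp add: has_real_derivative_iff_has_vector_derivative)
    qed
    show "(F \<longlongrightarrow> 0) at_top"
    proof (rule Lim_null_comparison)
      have "norm (F w) \<le> exp (- e * w) * ((\<bar>u\<bar> + e) / (e\<^sup>2 + u\<^sup>2))" for w
      proof -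
        have "\<bar>u * sin (u * w) - e * cos (u * w)\<bar> \<le> \<bar>u * sin (u * w)\<bar> + \<bar>e * cos (u * w)\<bar>" by linarith
        also have "\<dots> \<le> \<bar>u\<bar> + e"
          using assms by (intro add_mono) (auto simp: abs_mult mult_left_le)
        finally show ?thesis
          unfolding F_def using pos by (simp add: abs_mult divide_right_mono)
      qed
      then show "\<forall>\<^sub>F w in at_top. norm (F w) \<le> exp (- e * w) * ((\<bar>u\<bar> + e) / (e\<^sup>2 + u\<^sup>2))" by simp
      show "((\<lambda>w. exp (- e * w) * ((\<bar>u\<bar> + e) / (e\<^sup>2 + u\<^sup>2))) \<longlongrightarrow> 0) at_top"
        using tendsto_mult_right[OF e0, of "(\<bar>u\<bar> + e) / (e\<^sup>2 + u\<^sup>2)"]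
        by (simp only: mult_zero_left mult.commute)
    qed
  qed (auto intro!: continuous_intros)
  then have "has_bochner_integral lborel (\<lambda>w. indicator {0..} w *\<^sub>R (exp (- e * w) * cos (u * w))) (e / (e\<^sup>2 + u\<^sup>2))"
    using si by (simp add: has_bochner_integral_iff set_lebesgue_integral_def set_integrable_def F_def)
  then have "has_bochner_integral lborel (\<lambda>w. indicator {0..} w *\<^sub>R (exp (- e * \<bar>w\<bar>) * cos (u * w))) (e / (e\<^sup>2 + u\<^sup>2))"
    by (rule has_bochner_integral_cong[THEN iffD1, rotated -1]) (auto simp: indicator_def)
  then have "has_bochner_integral lborel (\<lambda>w. exp (- e * \<bar>w\<bar>) * cos (u * w)) (2 *\<^sub>R (e / (e\<^sup>2 + u\<^sup>2)))"
    by (rule has_bochner_integral_even_function) simp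
  then show "integrable lborel (\<lambda>w. exp (- e * \<bar>w\<bar>) * cos (u * w))"
    and "(LINT w|lborel. exp (- e * \<bar>w\<bar>) * cos (u * w)) = 2 * e / (e\<^sup>2 + u\<^sup>2)"
    by (auto simp: has_bochner_integral_iff)
qed

text \<open>The mass of the kernel left by Abel summation: this is where the constant
  \<open>2 * pi\<close> of \<open>plancherel\<close> comes from.\<close>

lemma cauchy_kernel: "integrable lborel (\<lambda>v::real. 2 / (1 + v\<^sup>2))"
  "(LINT v|lborel. 2 / (1 + v\<^sup>2)) = 2 * pi"
proof -
  have 1: "integrable lborel (\<lambda>v::real. inverse (1 + v\<^sup>2))" "(LINT v|lborel. inverse (1 + v\<^sup>2)) = pi"
    using integrable_inverse_1_plus_square LBINT_inverse_1_plus_square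
    by (auto simp: interval_lebesgue_integral_def set_integrable_def set_lebesgue_integral_def)
  then have "integrable lborel (\<lambda>v::real. 2 * inverse (1 + v\<^sup>2))" "(LINT v|lborel. 2 * inverse (1 + v\<^sup>2)) = 2 * pi"
    by auto
  then show "integrable lborel (\<lambda>v::real. 2 / (1 + v\<^sup>2))" "(LINT v|lborel. 2 / (1 + v\<^sup>2)) = 2 * pi"
    by (simp_all add: divide_inverse)
qed

text \<open>The squared modulus of the Fourier transform, split into cosine and sine parts so that
  all double integrals stay real.\<close>

definition fourier_sq :: "(real \<Rightarrow> real) \<Rightarrow> real \<Rightarrow> real" where
  "fourier_sq g w = (LINT t|lborel. g t * cos (w * t))\<^sup>2 + (LINT t|lborel. g t * sin (w * t))\<^sup>2"

text \<open>Continuity is asked for almost everywhere because the functions of interest are cut off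
  at 0 and may jump there; the bound \<open>C\<close> dominates their averages against the Cauchy
  kernel.\<close>

context
  fixes g :: "real \<Rightarrow> real" and C :: real
  assumes int_g: "integrable lborel g"
    and bound_g: "\<And>t. \<bar>g t\<bar> \<le> C"
    and cont_g: "AE t in lborel. isCont g t"
begin

lemma meas_g: "g \<in> borel_measurable borel"
  using int_g by simp

text \<open>By the addition theorem for the cosine, the squared transform becomes a double integral
  in which \<open>w\<close> occurs in a single cosine, ready to be integrated against the Abel
  factor.\<close>

lemma fourier_sq_eq:
  "fourier_sq g w = (LINT t|lborel. g t * (LINT s|lborel. g s * cos ((s - t) * w)))"
proof -
  note [measurable] = meas_g
  have ic: "integrable lborel (\<lambda>t. g t * cos (w * t))" and is': "integrable lborel (\<lambda>t. g t * sin (w * t))"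
    by (auto intro!: Bochner_Integration.integrable_bound[OF int_g] simp: abs_mult mult_left_le)
  have "(LINT s|lborel. g s * cos ((s - t) * w)) =
     (LINT s|lborel. g s * cos (w * s)) * cos (w * t) + (LINT s|lborel. g s * sin (w * s)) * sin (w * t)" for t
  proof -
    have "(LINT s|lborel. g s * cos ((s - t) * w)) =
      (LINT s|lborel. g s * cos (w * s) * cos (w * t) + g s * sin (w * s) * sin (w * t))"
      by (intro Bochner_Integration.integral_cong) (auto simp: left_diff_distrib cos_diff algebra_simps)
    also have "\<dots> = (LINT s|lborel. g s * cos (w * s)) * cos (w * t) + (LINT s|lborel. g s * sin (w * s)) * sin (w * t)"
      using ic is' by simp
    finally show ?thesis .
  qed
  then have "(LINT t|lborel. g t * (LINT s|lborel. g s * cos ((s - t) * w))) =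
     (LINT t|lborel. g t * cos (w * t) * (LINT s|lborel. g s * cos (w * s)) +
       g t * sin (w * t) * (LINT s|lborel. g s * sin (w * s)))"
    by (intro Bochner_Integration.integral_cong) (auto simp: algebra_simps)
  also have "\<dots> = fourier_sq g w"
    using ic is' by (simp add: fourier_sq_def power2_eq_square)
  finally show ?thesis ..
qed

text \<open>The substitution \<open>s = t + e * v\<close> moves \<open>e\<close> out of the kernel
  into the argument of \<open>g\<close>, where continuity controls \<open>e -> 0\<close>.\<close>

lemma integral_cauchy_kernel_scale:
  fixes e t :: real
  assumes "0 < e"
  shows "(LINT s|lborel. g s * (2 * e / (e\<^sup>2 + (s - t)\<^sup>2))) = (LINT v|lborel. g (t + e * v) * (2 / (1 + v\<^sup>2)))"
proof -
  note [measurable] = meas_g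
  have "(LINT s|lborel. g s * (2 * e / (e\<^sup>2 + (s - t)\<^sup>2))) =
     e * (LINT v|lborel. g (t + e * v) * (2 * e / (e\<^sup>2 + (e * v)\<^sup>2)))"
    using lborel_integral_real_affine[of e "\<lambda>s. g s * (2 * e / (e\<^sup>2 + (s - t)\<^sup>2))" t] assms by simp
  also have "\<dots> = (LINT v|lborel. e * (g (t + e * v) * (2 * e / (e\<^sup>2 + (e * v)\<^sup>2))))"
    by (rule integral_mult_right_zero[symmetric])
  also have "\<dots> = (LINT v|lborel. g (t + e * v) * (2 / (1 + v\<^sup>2)))"
  proof (intro Bochner_Integration.integral_cong refl)
    fix v :: real
    have "1 + v\<^sup>2 > 0" by (simp add: add_pos_nonneg)
    moreover have "e\<^sup>2 + (e * v)\<^sup>2 = e\<^sup>2 * (1 + v\<^sup>2)" by (simp add: power_mult_distrib algebra_simps)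
    ultimately show "e * (g (t + e * v) * (2 * e / (e\<^sup>2 + (e * v)\<^sup>2))) = g (t + e * v) * (2 / (1 + v\<^sup>2))"
      using assms by (simp add: power2_eq_square)
  qed
  finally show ?thesis .
qed

text \<open>The factor \<open>exp (- e * \<bar>w\<bar>)\<close> provides the absolute integrability
  that lets \<open>w\<close> be integrated first. This takes two exchanges, of \<open>w\<close> with
  \<open>t\<close> and then, for fixed \<open>t\<close>, of \<open>w\<close> with \<open>s\<close>;
  what remains inside is \<open>integral_exp_abs_cos\<close>.\<close>

lemma abel_mean_fourier_sq:
  fixes e :: real
  assumes "0 < e"
  shows "integrable lborel (\<lambda>w. exp (- e * \<bar>w\<bar>) * fourier_sq g w)" (is ?A)
    and "(LINT w|lborel. exp (- e * \<bar>w\<bar>) * fourier_sq g w) =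
       (LINT t|lborel. g t * (LINT v|lborel. g (t + e * v) * (2 / (1 + v\<^sup>2))))" (is ?B)
proof -
  note [measurable] = meas_g
  define k where "k = (\<lambda>w t. LINT s|lborel. g s * cos ((s - t) * w))"
  have k_meas [measurable]: "(\<lambda>p. k (fst p) (snd p)) \<in> borel_measurable (lborel \<Otimes>\<^sub>M lborel)"
    unfolding k_def by measurable
  have k_bound: "\<bar>k w t\<bar> \<le> (LINT s|lborel. \<bar>g s\<bar>)" for w t
  proof -
    have "\<bar>k w t\<bar> \<le> (LINT s|lborel. \<bar>g s * cos ((s - t) * w)\<bar>)"
      unfolding k_def by (rule integral_abs_bound)
    also have "\<dots> \<le> (LINT s|lborel. \<bar>g s\<bar>)"
      using int_g by (intro integral_mono' integrable_abs) (auto simp: abs_mult mult_left_le)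
    finally show ?thesis .
  qed
  have E: "integrable lborel (\<lambda>w. exp (- e * \<bar>w\<bar>))" using integrable_exp_abs_cos[OF assms, of 0] by simp
  have prod: "integrable (lborel \<Otimes>\<^sub>M lborel) (\<lambda>(w, t). exp (- e * \<bar>w\<bar>) * g t)"
    using E int_g by (intro lborel_pair.Fubini_integrable) (auto simp: abs_mult)
  have prodk: "integrable (lborel \<Otimes>\<^sub>M lborel) (\<lambda>(w, t). exp (- e * \<bar>w\<bar>) * (g t * k w t))"
  proof (rule Bochner_Integration.integrable_bound)
    show "integrable (lborel \<Otimes>\<^sub>M lborel) (\<lambda>p. (LINT s|lborel. \<bar>g s\<bar>) * (case p of (w, t) \<Rightarrow> exp (- e * \<bar>w\<bar>) * g t))"
      using prod by simp
    show "(\<lambda>(w, t). exp (- e * \<bar>w\<bar>) * (g t * k w t)) \<in> borel_measurable (lborel \<Otimes>\<^sub>M lborel)"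
      unfolding case_prod_unfold by measurable
    have "(LINT s|lborel. \<bar>g s\<bar>) \<ge> 0" by simp
    then show "AE x in lborel \<Otimes>\<^sub>M lborel. norm (case x of (w, t) \<Rightarrow> exp (- e * \<bar>w\<bar>) * (g t * k w t))
        \<le> norm ((LINT s|lborel. \<bar>g s\<bar>) * (case x of (w, t) \<Rightarrow> exp (- e * \<bar>w\<bar>) * g t))"
      by (intro AE_I2) (auto simp: abs_mult mult.commute mult.left_commute intro!: mult_left_mono k_bound split: prod.splits)
  qed
  have eq: "exp (- e * \<bar>w\<bar>) * fourier_sq g w = (LINT t|lborel. exp (- e * \<bar>w\<bar>) * (g t * k w t))" for w
    by (simp add: fourier_sq_eq k_def)
  show ?A
    unfolding eq using lborel_pair.integrable_fst'[OF prodk] by simp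
  have "(LINT w|lborel. exp (- e * \<bar>w\<bar>) * fourier_sq g w) =
      (LINT t|lborel. LINT w|lborel. exp (- e * \<bar>w\<bar>) * (g t * k w t))"
    unfolding eq using lborel_pair.Fubini_integral[OF prodk] by simp
  also have "\<dots> = (LINT t|lborel. g t * (LINT v|lborel. g (t + e * v) * (2 / (1 + v\<^sup>2))))"
  proof (intro Bochner_Integration.integral_cong refl)
    fix t :: real
    have prodc: "integrable (lborel \<Otimes>\<^sub>M lborel) (\<lambda>(w, s). exp (- e * \<bar>w\<bar>) * (g s * cos ((s - t) * w)))"
      by (rule Bochner_Integration.integrable_bound[OF prod])
        (auto intro!: AE_I2 simp: abs_mult mult_left_le case_prod_unfold)
    have "(LINT w|lborel. exp (- e * \<bar>w\<bar>) * (g t * k w t)) = g t * (LINT w|lborel. exp (- e * \<bar>w\<bar>) * k w t)"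
      by (simp add: mult.left_commute[of _ "g t"])
    also have "(LINT w|lborel. exp (- e * \<bar>w\<bar>) * k w t) =
        (LINT w|lborel. LINT s|lborel. exp (- e * \<bar>w\<bar>) * (g s * cos ((s - t) * w)))"
      by (simp add: k_def)
    also have "\<dots> = (LINT s|lborel. LINT w|lborel. exp (- e * \<bar>w\<bar>) * (g s * cos ((s - t) * w)))"
      using lborel_pair.Fubini_integral[OF prodc] by simp
    also have "\<dots> = (LINT s|lborel. g s * (2 * e / (e\<^sup>2 + (s - t)\<^sup>2)))"
    proof (intro Bochner_Integration.integral_cong refl)
      fix s
      have "(LINT w|lborel. exp (- e * \<bar>w\<bar>) * (g s * cos ((s - t) * w))) =
          (LINT w|lborel. g s * (exp (- e * \<bar>w\<bar>) * cos ((s - t) * w)))"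
        by (simp only: mult.left_commute)
      also have "\<dots> = g s * (LINT w|lborel. exp (- e * \<bar>w\<bar>) * cos ((s - t) * w))"
        by (rule integral_mult_right_zero)
      finally show "(LINT w|lborel. exp (- e * \<bar>w\<bar>) * (g s * cos ((s - t) * w))) =
          g s * (2 * e / (e\<^sup>2 + (s - t)\<^sup>2))"
        by (simp only: integral_exp_abs_cos[OF assms])
    qed
    also have "\<dots> = (LINT v|lborel. g (t + e * v) * (2 / (1 + v\<^sup>2)))"
      by (rule integral_cauchy_kernel_scale[OF assms])
    finally show "(LINT w|lborel. exp (- e * \<bar>w\<bar>) * (g t * k w t)) =
        g t * (LINT v|lborel. g (t + e * v) * (2 / (1 + v\<^sup>2)))" .
  qed
  finally show ?B .
qed

text \<open>Dominated convergence is used twice: inside, \<open>g (t + v / Suc n)\<close> tends to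
  \<open>g t\<close> at continuity points, under \<open>C * (2 / (1 + v\<^sup>2))\<close>; outside,
  the bound is \<open>\<bar>g t\<bar>\<close> times \<open>C * (2 * pi)\<close>.\<close>

lemma abel_mean_tendsto:
  "(\<lambda>n. LINT w|lborel. exp (- (1 / Suc n) * \<bar>w\<bar>) * fourier_sq g w) \<longlonglongrightarrow> 2 * pi * (LINT t|lborel. (g t)\<^sup>2)"
proof -
  note [measurable] = meas_g
  define K where "K = (\<lambda>n t. LINT v|lborel. g (t + (1 / Suc n) * v) * (2 / (1 + v\<^sup>2)))"
  have C: "C \<ge> 0" using bound_g[of 0] by linarith
  have pos: "0 \<le> 2 / (1 + v\<^sup>2)" for v :: real by (simp add: add_nonneg_nonneg)
  have K: "(\<lambda>n. K n t) \<longlonglongrightarrow> g t * (2 * pi)" if "isCont g t" for t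
  proof -
    have "(\<lambda>n. K n t) \<longlonglongrightarrow> (LINT v|lborel. g t * (2 / (1 + v\<^sup>2)))"
      unfolding K_def
    proof (rule integral_dominated_convergence[where w = "\<lambda>v. C * (2 / (1 + v\<^sup>2))"])
      show "integrable lborel (\<lambda>v. C * (2 / (1 + v\<^sup>2)))"
        using cauchy_kernel(1) by (intro integrable_mult_right)
      show "AE v in lborel. (\<lambda>n. g (t + 1 / real (Suc n) * v) * (2 / (1 + v\<^sup>2))) \<longlonglongrightarrow> g t * (2 / (1 + v\<^sup>2))"
      proof (intro AE_I2 tendsto_mult tendsto_const)
        fix v :: real
        have "(\<lambda>n. t + 1 / real (Suc n) * v) \<longlonglongrightarrow> t + 0 * v"
          by (intro tendsto_intros LIMSEQ_Suc lim_1_over_n)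
        then show "(\<lambda>n. g (t + 1 / real (Suc n) * v)) \<longlonglongrightarrow> g t"
          using isCont_tendsto_compose[OF that] by simp
      qed
      show "AE v in lborel. norm (g (t + 1 / real (Suc n) * v) * (2 / (1 + v\<^sup>2))) \<le> C * (2 / (1 + v\<^sup>2))" for n
        by (intro AE_I2) (auto simp: abs_mult abs_of_nonneg[OF pos] simp del: times_divide_eq_right intro!: mult_right_mono bound_g pos)
    qed measurable
    also have "(LINT v|lborel. g t * (2 / (1 + v\<^sup>2))) = g t * (2 * pi)"
      by (simp only: integral_mult_right_zero cauchy_kernel(2))
    finally show ?thesis .
  qed
  have Kb: "\<bar>K n t\<bar> \<le> C * (2 * pi)" for n t
  proof -
    have "\<bar>K n t\<bar> \<le> (LINT v|lborel. \<bar>g (t + (1 / Suc n) * v) * (2 / (1 + v\<^sup>2))\<bar>)"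
      unfolding K_def by (rule integral_abs_bound)
    also have "\<dots> \<le> (LINT v|lborel. C * (2 / (1 + v\<^sup>2)))"
      using cauchy_kernel(1)
      by (intro integral_mono' integrable_mult_right)
        (auto simp: abs_mult abs_of_nonneg[OF pos] simp del: times_divide_eq_right intro!: mult_right_mono bound_g pos mult_nonneg_nonneg C)
    also have "\<dots> = C * (2 * pi)"
      by (simp only: integral_mult_right_zero cauchy_kernel(2))
    finally show ?thesis .
  qed
  have "(\<lambda>n. LINT t|lborel. g t * K n t) \<longlonglongrightarrow> (LINT t|lborel. g t * (g t * (2 * pi)))"
  proof (rule integral_dominated_convergence[where w = "\<lambda>t. \<bar>g t\<bar> * (C * (2 * pi))"])
    show "integrable lborel (\<lambda>t. \<bar>g t\<bar> * (C * (2 * pi)))"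
      using int_g by (intro integrable_mult_left integrable_abs)
    show "AE t in lborel. (\<lambda>n. g t * K n t) \<longlonglongrightarrow> g t * (g t * (2 * pi))"
      using cont_g by eventually_elim (intro tendsto_mult tendsto_const K)
    show "AE t in lborel. norm (g t * K n t) \<le> \<bar>g t\<bar> * (C * (2 * pi))" for n
      by (intro AE_I2) (auto simp: abs_mult intro!: mult_left_mono Kb)
    show "(\<lambda>t. g t * K n t) \<in> borel_measurable lborel" for n
      unfolding K_def by measurable
  qed measurable
  moreover have "(LINT t|lborel. g t * (g t * (2 * pi))) = 2 * pi * (LINT t|lborel. (g t)\<^sup>2)"
    by (simp add: power2_eq_square mult.assoc[symmetric])
  moreover have "(LINT w|lborel. exp (- (1 / Suc n) * \<bar>w\<bar>) * fourier_sq g w) = (LINT t|lborel. g t * K n t)" for n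
    unfolding K_def by (rule abel_mean_fourier_sq(2)) simp
  ultimately show ?thesis by simp
qed

text \<open>As \<open>fourier_sq\<close> is nonnegative, the damped integrands increase to it, and
  monotone convergence identifies the undamped integral with the limit of the Abel means. Its
  finiteness is thereby obtained as a result.\<close>

lemma plancherel:
  "(\<integral>\<^sup>+ w. ennreal (fourier_sq g w) \<partial>lborel) = ennreal (2 * pi * (LINT t|lborel. (g t)\<^sup>2))"
proof -
  note [measurable] = meas_g
  define f where "f = (\<lambda>n w. ennreal (exp (- (1 / Suc n) * \<bar>w\<bar>) * fourier_sq g w))"
  have pos: "0 \<le> fourier_sq g w" for w by (simp add: fourier_sq_def)
  have [measurable]: "fourier_sq g \<in> borel_measurable borel"
    unfolding fourier_sq_def by measurable
  have inc: "incseq f"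
    unfolding f_def incseq_def le_fun_def
    by (intro allI impI ennreal_leI mult_right_mono pos) (auto intro!: mult_left_mono simp: field_simps)
  have "(\<integral>\<^sup>+ w. (SUP n. f n w) \<partial>lborel) = (SUP n. \<integral>\<^sup>+ w. f n w \<partial>lborel)"
    by (intro nn_integral_monotone_convergence_SUP inc) (auto simp: f_def)
  moreover have "(SUP n. f n w) = ennreal (fourier_sq g w)" for w
  proof (rule LIMSEQ_unique[OF LIMSEQ_SUP])
    show "incseq (\<lambda>n. f n w)" using inc by (auto simp: incseq_def le_fun_def)
    have "(\<lambda>n. exp (- (1 / Suc n) * \<bar>w\<bar>) * fourier_sq g w) \<longlonglongrightarrow> exp (- 0 * \<bar>w\<bar>) * fourier_sq g w"
      by (intro tendsto_intros LIMSEQ_Suc lim_1_over_n)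
    then show "(\<lambda>n. f n w) \<longlonglongrightarrow> ennreal (fourier_sq g w)"
      unfolding f_def by (intro tendsto_ennrealI) simp
  qed
  moreover have "(SUP n. \<integral>\<^sup>+ w. f n w \<partial>lborel) = ennreal (2 * pi * (LINT t|lborel. (g t)\<^sup>2))"
  proof (rule LIMSEQ_unique[OF LIMSEQ_SUP])
    show "incseq (\<lambda>n. \<integral>\<^sup>+ w. f n w \<partial>lborel)"
      using inc by (auto simp: incseq_def le_fun_def intro!: nn_integral_mono)
    have "(\<integral>\<^sup>+ w. f n w \<partial>lborel) = ennreal (LINT w|lborel. exp (- (1 / Suc n) * \<bar>w\<bar>) * fourier_sq g w)" for n
      unfolding f_def by (intro nn_integral_eq_integral abel_mean_fourier_sq(1)) (auto simp: pos)
    then show "(\<lambda>n. \<integral>\<^sup>+ w. f n w \<partial>lborel) \<longlonglongrightarrow> ennreal (2 * pi * (LINT t|lborel. (g t)\<^sup>2))"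
      using tendsto_ennrealI[OF abel_mean_tendsto] by simp
  qed
  ultimately show ?thesis by simp
qed

end

section \<open>Laplace transforms and the H2 norm\<close>

text \<open>Left of the origin only continuity is required: the Laplace transform does not see it.\<close>

definition tame :: "(real \<Rightarrow> 'a::real_normed_vector) \<Rightarrow> bool" where
  "tame X \<longleftrightarrow> (\<forall>t. isCont X t) \<and> (\<exists>C. \<forall>t\<ge>0. norm (X t) \<le> C)"

lemma tame_bounded_linear:
  assumes "bounded_linear h" "tame X"
  shows "tame (\<lambda>t. h (X t))"
proof -
  obtain C where C: "\<And>t. 0 \<le> t \<Longrightarrow> norm (X t) \<le> C" using assms(2) unfolding tame_def by blast
  obtain K where K: "0 \<le> K" "\<And>x. norm (h x) \<le> norm x * K"
    using bounded_linear.nonneg_bounded[OF assms(1)] by blast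
  have "norm (h (X t)) \<le> C * K" if "0 \<le> t" for t
    using order_trans[OF K(2) mult_right_mono[OF C[OF that] K(1)]] .
  moreover have "isCont (\<lambda>t. h (X t)) t" for t
    using assms bounded_linear.isCont unfolding tame_def by blast
  ultimately show ?thesis unfolding tame_def by blast
qed

lemma tame_matrix_mult_left: "tame X \<Longrightarrow> tame (\<lambda>t. (U :: real^'n^'m) ** (X t :: real^'p^'n))"
  by (rule tame_bounded_linear[OF matrix_mult.bounded_linear_right])

lemma tame_matrix_mult_right: "tame X \<Longrightarrow> tame (\<lambda>t. (X t :: real^'n^'m) ** (V :: real^'p^'n))"
  by (rule tame_bounded_linear[OF matrix_mult.bounded_linear_left])

lemma tame_component: "tame X \<Longrightarrow> tame (\<lambda>t. (X t :: real^'n^'m) $ i $ j)"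
  by (rule tame_bounded_linear[OF bounded_linear_matrix_component])

definition laplace :: "(real \<Rightarrow> real) \<Rightarrow> complex \<Rightarrow> complex" where
  "laplace f s = (LINT t:{0..}|lborel. exp (- (s * of_real t)) * of_real (f t))"

lemma set_integrable_exp_tame:
  assumes f: "tame f" and r: "0 < r"
  shows "set_integrable lborel {0..} (\<lambda>t. exp (- r * t) * f t)"
proof -
  obtain C where C: "\<And>t. 0 \<le> t \<Longrightarrow> norm (f t) \<le> C" using f unfolding tame_def by blast
  have [measurable]: "f \<in> borel_measurable borel"
    using f unfolding tame_def
    by (intro borel_measurable_continuous_onI continuous_at_imp_continuous_on) auto
  have "set_integrable lborel {0..} (\<lambda>t. C * exp (- r * t))"
    by (intro set_integrable_mult_right set_integrable_exp_minus_Ici r)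
  then show ?thesis
  proof (rule set_integrable_bound)
    show "set_borel_measurable lborel {0..} (\<lambda>t. exp (- r * t) * f t)"
      unfolding set_borel_measurable_def by measurable
    show "AE t in lborel. t \<in> {0..} \<longrightarrow> norm (exp (- r * t) * f t) \<le> norm (C * exp (- r * t))"
      using C by (intro AE_I2) (force simp: abs_mult intro: order_trans)
  qed
qed

lemma set_integrable_laplace:
  assumes f: "tame f" and s: "0 < Re s"
  shows "set_integrable lborel {0..} (\<lambda>t. exp (- (s * of_real t)) * of_real (f t))"
proof (rule set_integrable_bound[OF set_integrable_exp_tame[OF f s]])
  have [measurable]: "f \<in> borel_measurable borel"
    using f unfolding tame_def
    by (intro borel_measurable_continuous_onI continuous_at_imp_continuous_on) auto
  show "set_borel_measurable lborel {0..} (\<lambda>t. exp (- (s * of_real t)) * of_real (f t) :: complex)"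
    unfolding set_borel_measurable_def by measurable
qed (auto simp: norm_mult norm_exp_eq_Re abs_mult)

lemma laplace_sum:
  assumes "\<And>k. k \<in> I \<Longrightarrow> tame (f k)" and s: "0 < Re s"
  shows "laplace (\<lambda>t. \<Sum>k\<in>I. c k * f k t) s = (\<Sum>k\<in>I. of_real (c k) * laplace (f k) s)"
proof -
  have int: "integrable lborel (\<lambda>t. indicator {0..} t *\<^sub>R (exp (- (s * of_real t)) * of_real (f k t)) :: complex)"
    if "k \<in> I" for k
    using set_integrable_laplace[OF assms(1)[OF that] s] by (simp add: set_integrable_def)
  have "laplace (\<lambda>t. \<Sum>k\<in>I. c k * f k t) s =
      (LINT t|lborel. (\<Sum>k\<in>I. of_real (c k) * (indicator {0..} t *\<^sub>R (exp (- (s * of_real t)) * of_real (f k t)))))"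
    unfolding laplace_def set_lebesgue_integral_def
    by (intro Bochner_Integration.integral_cong refl)
      (simp add: scaleR_sum_right sum_distrib_left mult_ac)
  also have "\<dots> = (\<Sum>k\<in>I. (LINT t|lborel. of_real (c k) * (indicator {0..} t *\<^sub>R (exp (- (s * of_real t)) * of_real (f k t)))))"
    by (intro Bochner_Integration.integral_sum integrable_mult_right int)
  also have "\<dots> = (\<Sum>k\<in>I. of_real (c k) * laplace (f k) s)"
    by (simp only: integral_mult_right_zero laplace_def set_lebesgue_integral_def)
  finally show ?thesis .
qed

text \<open>Integrates the derivative of \<open>exp (- s t) * f t\<close> over the half-line; the
  boundary term at infinity vanishes because \<open>f\<close> is bounded there and
  \<open>0 < Re s\<close>.\<close>

lemma laplace_derivative:
  assumes f: "tame f" and f': "tame f'" and s: "0 < Re s"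
    and deriv: "\<And>t. (f has_real_derivative f' t) (at t)"
  shows "laplace f' s = s * laplace f s - of_real (f 0)"
proof -
  let ?e = "\<lambda>t. exp (- (s * of_real t))"
  note i = set_integrable_laplace[OF f s] and i' = set_integrable_laplace[OF f' s]
  have is': "set_integrable lborel {0..} (\<lambda>t. s * (?e t * of_real (f t)))"
    by (intro set_integrable_mult_right i)
  have "(LINT t:{0..}|lborel. ?e t * of_real (f' t) - s * (?e t * of_real (f t))) = 0 - ?e 0 * of_real (f 0)"
  proof (rule set_integral_FTC_Ici)
    show "((\<lambda>t. ?e t * of_real (f t)) has_vector_derivative
        ?e t * of_real (f' t) - s * (?e t * of_real (f t))) (at t)" for t
    proof -
      have "((\<lambda>z. exp (- (s * z))) has_field_derivative - s * exp (- (s * of_real t))) (at (of_real t))"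
        by (auto intro!: derivative_eq_intros)
      moreover have "(complex_of_real has_vector_derivative 1) (at t)"
        using has_vector_derivative_of_real[OF DERIV_ident] by simp
      ultimately have "(?e has_vector_derivative - s * ?e t) (at t)"
        using field_vector_diff_chain_at[where f = complex_of_real and g = "\<lambda>z. exp (- (s * z))"]
        by (fastforce simp: o_def)
      moreover have "((\<lambda>t. complex_of_real (f t)) has_vector_derivative of_real (f' t)) (at t)"
        by (rule has_vector_derivative_of_real[OF deriv])
      ultimately show ?thesis
        using has_vector_derivative_mult[of ?e "- s * ?e t" t UNIV "\<lambda>t. of_real (f t)" "of_real (f' t)"]
        by (simp add: mult.assoc)
    qed
    show "isCont (\<lambda>t. ?e t * of_real (f' t) - s * (?e t * of_real (f t))) t" for t
      using f f' unfolding tame_def by (intro continuous_intros) auto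
    show "set_integrable lborel {0..} (\<lambda>t. ?e t * of_real (f' t) - s * (?e t * of_real (f t)))"
      by (intro set_integral_diff i' is')
    show "((\<lambda>t. ?e t * of_real (f t)) \<longlongrightarrow> 0) at_top"
    proof -
      obtain C where C: "\<And>t. 0 \<le> t \<Longrightarrow> norm (f t) \<le> C" using f unfolding tame_def by blast
      show ?thesis
      proof (rule Lim_null_comparison)
        show "\<forall>\<^sub>F t in at_top. norm (?e t * of_real (f t)) \<le> exp (- Re s * t) * C"
          using eventually_ge_at_top[of 0]
          by eventually_elim (use C in \<open>auto simp: norm_mult norm_exp_eq_Re\<close>)
        show "((\<lambda>t. exp (- Re s * t) * C) \<longlongrightarrow> 0) at_top"
          using s by real_asymp
      qed
    qed
  qed
  then show ?thesis
    using set_integral_diff(2)[OF i' is'] by (simp add: laplace_def diff_eq_eq)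
qed

text \<open>On the line \<open>Re s = r\<close> the Laplace transform of \<open>f\<close> is the
  Fourier transform of \<open>exp (- r * t) * f t\<close> cut off at 0, which is bounded, integrable
  and continuous away from 0.\<close>

lemma laplace_plancherel:
  assumes f: "tame f" and r: "0 < r"
  shows "ennreal (1 / (2 * pi)) * (\<integral>\<^sup>+ w. ennreal ((cmod (laplace f (Complex r w)))\<^sup>2) \<partial>lborel) =
    (\<integral>\<^sup>+ t\<in>{0..}. ennreal ((exp (- r * t) * f t)\<^sup>2) \<partial>lborel)"
proof -
  obtain C where C: "\<And>t. 0 \<le> t \<Longrightarrow> norm (f t) \<le> C" using f unfolding tame_def by blast
  then have C0: "0 \<le> C" using norm_ge_zero order_trans order_refl by metis
  have cont: "isCont f t" for t using f unfolding tame_def by blast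
  define g where "g = (\<lambda>t. indicator {0..} t * (exp (- r * t) * f t))"
  have ig: "integrable lborel g"
    using set_integrable_exp_tame[OF f r] unfolding g_def set_integrable_def by simp
  have bg: "\<bar>g t\<bar> \<le> C" for t
  proof (cases "0 \<le> t")
    case True
    then have "exp (- r * t) * \<bar>f t\<bar> \<le> 1 * C"
      using C[of t] r by (intro mult_mono) auto
    then show ?thesis using True by (simp add: g_def abs_mult)
  qed (use C0 in \<open>simp add: g_def\<close>)
  have "AE t in lborel. isCont g t"
    using AE_lborel_singleton[of 0]
  proof eventually_elim
    case (elim t)
    consider "t < 0" | "0 < t" using elim by linarith
    then show ?case
    proof cases
      case 1
      have "\<forall>\<^sub>F x in nhds t. g x = 0"
        using eventually_nhds_in_open[of "{..<0}" t] 1 by (auto elim!: eventually_mono simp: g_def)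
      then show ?thesis using isCont_cong[of g "\<lambda>_. 0" t] by simp
    next
      case 2
      have "\<forall>\<^sub>F x in nhds t. g x = exp (- r * x) * f x"
        using eventually_nhds_in_open[of "{0<..}" t] 2 by (auto elim!: eventually_mono simp: g_def)
      moreover have "isCont (\<lambda>x. exp (- r * x) * f x) t" by (intro continuous_intros cont)
      ultimately show ?thesis using isCont_cong[of g _ t] by simp
    qed
  qed
  note pl = plancherel[OF ig bg this]
  have "(cmod (laplace f (Complex r w)))\<^sup>2 = fourier_sq g w" for w
  proof -
    have int: "integrable lborel (\<lambda>t. indicator {0..} t *\<^sub>R (exp (- (Complex r w * of_real t)) * of_real (f t)))"
      using set_integrable_laplace[OF f, of "Complex r w"] r by (simp add: set_integrable_def)
    have "Re (laplace f (Complex r w)) =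
        (LINT t|lborel. Re (indicator {0..} t *\<^sub>R (exp (- (Complex r w * of_real t)) * of_real (f t))))"
      unfolding laplace_def set_lebesgue_integral_def by (rule integral_Re[OF int, symmetric])
    also have "\<dots> = (LINT t|lborel. g t * cos (w * t))"
      by (intro Bochner_Integration.integral_cong) (auto simp: g_def Re_exp)
    finally have re: "Re (laplace f (Complex r w)) = (LINT t|lborel. g t * cos (w * t))" .
    have "Im (laplace f (Complex r w)) =
        (LINT t|lborel. Im (indicator {0..} t *\<^sub>R (exp (- (Complex r w * of_real t)) * of_real (f t))))"
      unfolding laplace_def set_lebesgue_integral_def by (rule integral_Im[OF int, symmetric])
    also have "\<dots> = (LINT t|lborel. - (g t * sin (w * t)))"
      by (intro Bochner_Integration.integral_cong) (auto simp: g_def Im_exp)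
    finally have "Im (laplace f (Complex r w)) = - (LINT t|lborel. g t * sin (w * t))"
      by simp
    \<comment> \<open>The minus sign of the sine part disappears on squaring.\<close>
    with re show ?thesis by (simp add: cmod_power2 fourier_sq_def)
  qed
  then have "ennreal (1 / (2 * pi)) * (\<integral>\<^sup>+ w. ennreal ((cmod (laplace f (Complex r w)))\<^sup>2) \<partial>lborel) =
      ennreal (1 / (2 * pi)) * ennreal (2 * pi * (LINT t|lborel. (g t)\<^sup>2))"
    using pl by simp
  also have "\<dots> = ennreal (LINT t|lborel. (g t)\<^sup>2)"
    by (subst ennreal_mult'[symmetric]) auto
  also have "\<dots> = (\<integral>\<^sup>+ t. ennreal ((g t)\<^sup>2) \<partial>lborel)"
  proof (rule nn_integral_eq_integral[symmetric])
    have [measurable]: "g \<in> borel_measurable borel" using ig by simp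
    show "integrable lborel (\<lambda>t. (g t)\<^sup>2)"
    proof (rule Bochner_Integration.integrable_bound)
      show "integrable lborel (\<lambda>t. C * g t)" using ig by simp
      show "AE t in lborel. norm ((g t)\<^sup>2) \<le> norm (C * g t)"
      proof (rule AE_I2)
        fix t
        have "\<bar>g t\<bar> * \<bar>g t\<bar> \<le> C * \<bar>g t\<bar>" by (intro mult_right_mono bg) auto
        then show "norm ((g t)\<^sup>2) \<le> norm (C * g t)"
          using C0 by (simp add: power2_eq_square abs_mult)
      qed
    qed measurable
  qed simp
  also have "\<dots> = (\<integral>\<^sup>+ t\<in>{0..}. ennreal ((exp (- r * t) * f t)\<^sup>2) \<partial>lborel)"
    by (intro nn_integral_cong) (auto simp: g_def indicator_def)
  finally show ?thesis .
qed

section \<open>The H2 norm as an energy in the time domain\<close>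

lemma norm_matrix_power2:
  fixes A :: "'a::real_normed_vector^'n^'m"
  shows "(norm A)\<^sup>2 = (\<Sum>i\<in>UNIV. \<Sum>j\<in>UNIV. (norm (A $ i $ j))\<^sup>2)"
  by (simp add: norm_vec_def L2_set_def sum_nonneg)

text \<open>The damping is at most 1, which gives one inequality; for the other, the rates
  \<open>r = 1 / Suc n\<close> make the integrands increase to \<open>h\<close> on the half-line.
  Working in \<open>ennreal\<close> allows both sides to be infinite.\<close>

lemma SUP_exp_damping:
  fixes h :: "real \<Rightarrow> real"
  assumes [measurable]: "h \<in> borel_measurable borel" and h: "\<And>t. 0 \<le> h t"
  shows "(SUP r\<in>{0<..}. \<integral>\<^sup>+ t\<in>{0..}. ennreal ((exp (- r * t))\<^sup>2 * h t) \<partial>lborel) =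
    (\<integral>\<^sup>+ t\<in>{0..}. ennreal (h t) \<partial>lborel)"
proof (rule antisym)
  show "(SUP r\<in>{0<..}. \<integral>\<^sup>+ t\<in>{0..}. ennreal ((exp (- r * t))\<^sup>2 * h t) \<partial>lborel) \<le>
      (\<integral>\<^sup>+ t\<in>{0..}. ennreal (h t) \<partial>lborel)"
  proof (intro SUP_least nn_integral_mono)
    fix r t :: real assume "r \<in> {0<..}"
    then have "(exp (- r * t))\<^sup>2 * h t \<le> 1 * h t" if "0 \<le> t"
      using that h[of t] by (intro mult_right_mono power_le_one) auto
    then show "ennreal ((exp (- r * t))\<^sup>2 * h t) * indicator {0..} t \<le> ennreal (h t) * indicator {0..} t"
      by (auto simp: indicator_def intro!: ennreal_leI)
  qed
  define f where "f = (\<lambda>n t. ennreal ((exp (- (1 / Suc n) * t))\<^sup>2 * h t) * indicator {0..} t)"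
  have inc: "incseq f"
    unfolding f_def incseq_def le_fun_def
  proof (intro allI impI)
    fix m n :: nat and t :: real assume mn: "m \<le> n"
    have "(exp (- (1 / Suc m) * t))\<^sup>2 * h t \<le> (exp (- (1 / Suc n) * t))\<^sup>2 * h t" if "0 \<le> t"
    proof (intro mult_right_mono power_mono h)
      have "1 / real (Suc n) \<le> 1 / real (Suc m)" using mn by (simp add: field_simps)
      then have "1 / real (Suc n) * t \<le> 1 / real (Suc m) * t" using that by (rule mult_right_mono)
      then show "exp (- (1 / Suc m) * t) \<le> exp (- (1 / Suc n) * t)" by simp
    qed auto
    then show "ennreal ((exp (- (1 / Suc m) * t))\<^sup>2 * h t) * indicator {0..} t
        \<le> ennreal ((exp (- (1 / Suc n) * t))\<^sup>2 * h t) * indicator {0..} t"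
      by (auto simp: indicator_def intro!: ennreal_leI)
  qed
  have "(SUP n. f n t) = ennreal (h t) * indicator {0..} t" for t
  proof (rule LIMSEQ_unique[OF LIMSEQ_SUP])
    show "incseq (\<lambda>n. f n t)" using inc by (auto simp: incseq_def le_fun_def)
    have "(\<lambda>n. (exp (- (1 / Suc n) * t))\<^sup>2 * h t) \<longlonglongrightarrow> (exp (- 0 * t))\<^sup>2 * h t"
      by (intro tendsto_intros LIMSEQ_Suc lim_1_over_n)
    then have "(\<lambda>n. ennreal ((exp (- (1 / Suc n) * t))\<^sup>2 * h t)) \<longlonglongrightarrow> ennreal (h t)"
      by (intro tendsto_ennrealI) simp
    then show "(\<lambda>n. f n t) \<longlonglongrightarrow> ennreal (h t) * indicator {0..} t"
      unfolding f_def by (cases "0 \<le> t") auto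
  qed
  then have "(\<integral>\<^sup>+ t\<in>{0..}. ennreal (h t) \<partial>lborel) = (\<integral>\<^sup>+ t. (SUP n. f n t) \<partial>lborel)"
    by simp
  also have "\<dots> = (SUP n. \<integral>\<^sup>+ t. f n t \<partial>lborel)"
    by (intro nn_integral_monotone_convergence_SUP inc) (simp add: f_def)
  also have "\<dots> \<le> (SUP r\<in>{0<..}. \<integral>\<^sup>+ t\<in>{0..}. ennreal ((exp (- r * t))\<^sup>2 * h t) \<partial>lborel)"
  proof (rule SUP_least)
    fix n :: nat
    show "(\<integral>\<^sup>+ t. f n t \<partial>lborel) \<le>
        (SUP r\<in>{0<..}. \<integral>\<^sup>+ t\<in>{0..}. ennreal ((exp (- r * t))\<^sup>2 * h t) \<partial>lborel)"
      unfolding f_def by (rule SUP_upper) simp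
  qed
  finally show "(\<integral>\<^sup>+ t\<in>{0..}. ennreal (h t) \<partial>lborel) \<le>
      (SUP r\<in>{0<..}. \<integral>\<^sup>+ t\<in>{0..}. ennreal ((exp (- r * t))\<^sup>2 * h t) \<partial>lborel)" .
qed

text \<open>The Frobenius norm splits the energy into entries, to which the scalar identity applies
  on each line \<open>Re s = r\<close>; the supremum over the lines then removes the damping.
  \<open>G\<close> is compared with a Laplace transform only in the open half-plane, which excludes
  the pole at 0.\<close>

lemma h2_norm_sq_laplace:
  fixes g :: "real \<Rightarrow> real^'p^'q"
  assumes g: "tame g"
    and G: "\<And>s i j. 0 < Re s \<Longrightarrow> G s $ i $ j = laplace (\<lambda>t. g t $ i $ j) s"
  shows "h2_norm_sq G = (\<integral>\<^sup>+ t\<in>{0..}. ennreal ((norm (g t))\<^sup>2) \<partial>lborel)"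
proof -
  have [measurable]: "(\<lambda>t. g t $ i $ j) \<in> borel_measurable borel" for i j
    using tame_component[OF g, of i j] unfolding tame_def
    by (intro borel_measurable_continuous_onI continuous_at_imp_continuous_on) auto
  have "ennreal (1 / (2 * pi)) * (\<integral>\<^sup>+ w. ennreal ((norm (G (Complex r w)))\<^sup>2) \<partial>lborel) =
      (\<integral>\<^sup>+ t\<in>{0..}. ennreal ((exp (- r * t))\<^sup>2 * (norm (g t))\<^sup>2) \<partial>lborel)" if r: "0 < r" for r
  proof -
    have sum2: "(\<integral>\<^sup>+ t. (\<Sum>i\<in>UNIV. \<Sum>j\<in>UNIV. h i j t) \<partial>lborel) = (\<Sum>i\<in>UNIV. \<Sum>j\<in>UNIV. \<integral>\<^sup>+ t. h i j t \<partial>lborel)"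
      if "\<And>i j. h i j \<in> borel_measurable lborel" for h :: "'q \<Rightarrow> 'p \<Rightarrow> real \<Rightarrow> ennreal"
      using that by (simp add: nn_integral_sum)
    have [measurable]: "(\<lambda>w. laplace (\<lambda>t. g t $ i $ j) (Complex r w)) \<in> borel_measurable borel" for i j
      unfolding laplace_def set_lebesgue_integral_def Complex_eq by measurable
    have "(norm (G (Complex r w)))\<^sup>2 = (\<Sum>i\<in>UNIV. \<Sum>j\<in>UNIV. (cmod (laplace (\<lambda>t. g t $ i $ j) (Complex r w)))\<^sup>2)" for w
      using r by (simp add: norm_matrix_power2 G)
    then have "ennreal ((norm (G (Complex r w)))\<^sup>2) =
        (\<Sum>i\<in>UNIV. \<Sum>j\<in>UNIV. ennreal ((cmod (laplace (\<lambda>t. g t $ i $ j) (Complex r w)))\<^sup>2))" for w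
      by (simp only: sum_ennreal sum_nonneg zero_le_power2)
    then have "ennreal (1 / (2 * pi)) * (\<integral>\<^sup>+ w. ennreal ((norm (G (Complex r w)))\<^sup>2) \<partial>lborel) =
        (\<Sum>i\<in>UNIV. \<Sum>j\<in>UNIV. ennreal (1 / (2 * pi)) * (\<integral>\<^sup>+ w. ennreal ((cmod (laplace (\<lambda>t. g t $ i $ j) (Complex r w)))\<^sup>2) \<partial>lborel))"
      by (simp add: nn_integral_sum sum_distrib_left del: sum_ennreal)
    also have "\<dots> = (\<Sum>i\<in>UNIV. \<Sum>j\<in>UNIV. \<integral>\<^sup>+ t\<in>{0..}. ennreal ((exp (- r * t) * g t $ i $ j)\<^sup>2) \<partial>lborel)"
      by (simp only: laplace_plancherel[OF tame_component[OF g] r])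
    also have "\<dots> = (\<integral>\<^sup>+ t. (\<Sum>i\<in>UNIV. \<Sum>j\<in>UNIV. ennreal ((exp (- r * t) * g t $ i $ j)\<^sup>2) * indicator {0..} t) \<partial>lborel)"
    proof (rule sum2[symmetric])
      show "(\<lambda>t. ennreal ((exp (- r * t) * g t $ i $ j)\<^sup>2) * indicator {0..} t) \<in> borel_measurable lborel" for i j
        by measurable
    qed
    also have "\<dots> = (\<integral>\<^sup>+ t\<in>{0..}. ennreal ((exp (- r * t))\<^sup>2 * (norm (g t))\<^sup>2) \<partial>lborel)"
    proof (intro nn_integral_cong)
      fix t
      have "(exp (- r * t))\<^sup>2 * (norm (g t))\<^sup>2 = (\<Sum>i\<in>UNIV. \<Sum>j\<in>UNIV. (exp (- r * t) * g t $ i $ j)\<^sup>2)"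
        by (simp add: norm_matrix_power2 sum_distrib_left power_mult_distrib)
      then have "ennreal ((exp (- r * t))\<^sup>2 * (norm (g t))\<^sup>2) =
          (\<Sum>i\<in>UNIV. \<Sum>j\<in>UNIV. ennreal ((exp (- r * t) * g t $ i $ j)\<^sup>2))"
        by (simp only: sum_ennreal sum_nonneg zero_le_power2)
      then show "(\<Sum>i\<in>UNIV. \<Sum>j\<in>UNIV. ennreal ((exp (- r * t) * g t $ i $ j)\<^sup>2) * indicator {0..} t) =
          ennreal ((exp (- r * t))\<^sup>2 * (norm (g t))\<^sup>2) * indicator {0..} t"
        by (simp add: indicator_def)
    qed
    finally show ?thesis .
  qed
  then have "h2_norm_sq G = (SUP r\<in>{0<..}. \<integral>\<^sup>+ t\<in>{0..}. ennreal ((exp (- r * t))\<^sup>2 * (norm (g t))\<^sup>2) \<partial>lborel)"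
    unfolding h2_norm_sq_def by (intro SUP_cong) auto
  also have "\<dots> = (\<integral>\<^sup>+ t\<in>{0..}. ennreal ((norm (g t))\<^sup>2) \<partial>lborel)"
  proof (rule SUP_exp_damping)
    show "(\<lambda>t. (norm (g t))\<^sup>2) \<in> borel_measurable borel"
      unfolding norm_matrix_power2 by measurable
  qed simp
  finally show ?thesis .
qed

section \<open>The resolvent\<close>

definition mlaplace :: "(real \<Rightarrow> real^'n^'m) \<Rightarrow> complex \<Rightarrow> complex^'n^'m" where
  "mlaplace X s = (\<chi> i j. laplace (\<lambda>t. X t $ i $ j) s)"

lemma mlaplace_mult_left:
  fixes U :: "real^'n^'m" and X :: "real \<Rightarrow> real^'p^'n"
  assumes "tame X" "0 < Re s"
  shows "cmat U ** mlaplace X s = mlaplace (\<lambda>t. U ** X t) s"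
proof -
  have "(\<Sum>k\<in>UNIV. of_real (U $ i $ k) * laplace (\<lambda>t. X t $ k $ j) s) =
      laplace (\<lambda>t. \<Sum>k\<in>UNIV. U $ i $ k * X t $ k $ j) s" for i j
    by (rule laplace_sum[symmetric]) (intro tame_component assms)+
  then show ?thesis
    by (simp add: vec_eq_iff matrix_matrix_mult_def mlaplace_def)
qed

lemma mlaplace_mult_right:
  fixes X :: "real \<Rightarrow> real^'n^'m" and V :: "real^'p^'n"
  assumes "tame X" "0 < Re s"
  shows "mlaplace X s ** cmat V = mlaplace (\<lambda>t. X t ** V) s"
proof -
  have "(\<Sum>k\<in>UNIV. of_real (V $ k $ j) * laplace (\<lambda>t. X t $ i $ k) s) =
      laplace (\<lambda>t. \<Sum>k\<in>UNIV. V $ k $ j * X t $ i $ k) s" for i j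
    by (rule laplace_sum[symmetric]) (intro tame_component assms)+
  then show ?thesis
    by (simp add: vec_eq_iff matrix_matrix_mult_def mlaplace_def mult.commute)
qed

lemma mat_scalar_mult_component:
  "(mat s ** X) $ i $ j = s * X $ i $ j" for X :: "'a::semiring_1^'p^'n"
  by (simp add: matrix_matrix_mult_def mat_def if_distrib[of "\<lambda>x. x * _"] cong: if_cong)

lemma mat_scalar_mult_component_right:
  "(X ** mat s) $ i $ j = X $ i $ j * s" for X :: "'a::semiring_1^'n^'p"
  by (simp add: matrix_matrix_mult_def mat_def if_distrib[of "\<lambda>x. _ * x"] cong: if_cong)

lemma cmat_mult: "cmat (A ** B) = cmat A ** cmat B"
  by (simp add: vec_eq_iff matrix_matrix_mult_def)

lemma cmat_mat_1: "cmat (mat 1) = mat 1"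
  by (simp add: vec_eq_iff mat_def)

text \<open>\<open>matrix_inv\<close> is a Hilbert choice; a right inverse of a square matrix over a
  field is also a left inverse, and this determines the chosen matrix.\<close>

lemma matrix_inv_eqI:
  fixes A B :: "'a::field^'n^'n"
  assumes "A ** B = mat 1"
  shows "matrix_inv A = B"
proof -
  have "B ** A = mat 1" by (rule matrix_left_right_inverse1[OF assms])
  then have "A ** matrix_inv A = mat 1 \<and> matrix_inv A ** A = mat 1"
    unfolding matrix_inv_def
    using someI[of "\<lambda>A'. A ** A' = mat 1 \<and> A' ** A = mat 1" B] assms by blast
  moreover have "B ** (A ** matrix_inv A) = (B ** A) ** matrix_inv A"
    by (rule matrix_mul_assoc)
  ultimately show ?thesis
    using \<open>B ** A = mat 1\<close> by simp
qed

text \<open>Transforming \<open>E' = - A E\<close>, \<open>E(0) = 1\<close> entry by entry gives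
  \<open>- A R = s R - 1\<close> for the transform \<open>R\<close> of \<open>E\<close>.\<close>

lemma mlaplace_semigroup_inverse:
  fixes A :: "real^'n^'n"
  assumes E: "tame (\<lambda>t. matrix_exp (- t *\<^sub>R A))" and s: "0 < Re s"
  shows "(mat s + cmat A) ** mlaplace (\<lambda>t. matrix_exp (- t *\<^sub>R A)) s = mat 1"
proof -
  let ?E = "\<lambda>t. matrix_exp (- t *\<^sub>R A)"
  have add_mult: "(X + Y) ** Z = X ** Z + Y ** Z" for X Y Z :: "complex^'n^'n"
    by (simp add: vec_eq_iff matrix_matrix_mult_def distrib_right sum.distrib)
  have "s * laplace (\<lambda>t. ?E t $ i $ j) s + laplace (\<lambda>t. (A ** ?E t) $ i $ j) s = mat 1 $ i $ j" for i j
  proof -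
    have AE: "tame (\<lambda>t. - ((A ** ?E t) $ i $ j))"
      by (intro tame_bounded_linear[OF bounded_linear_minus[OF bounded_linear_ident]] tame_component tame_matrix_mult_left E)
    have "laplace (\<lambda>t. - ((A ** ?E t) $ i $ j)) s = s * laplace (\<lambda>t. ?E t $ i $ j) s - of_real (?E 0 $ i $ j)"
      using has_vector_derivative_matrix_component[OF matrix_exp_minus_has_vector_derivative[where A = A]]
      by (intro laplace_derivative tame_component E AE s) auto
    moreover have "laplace (\<lambda>t. - ((A ** ?E t) $ i $ j)) s = - laplace (\<lambda>t. (A ** ?E t) $ i $ j) s"
      by (simp add: laplace_def set_lebesgue_integral_def)
    ultimately have eq: "- laplace (\<lambda>t. (A ** ?E t) $ i $ j) s = s * laplace (\<lambda>t. ?E t $ i $ j) s - of_real (?E 0 $ i $ j)"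
      by simp
    have "s * laplace (\<lambda>t. ?E t $ i $ j) s + laplace (\<lambda>t. (A ** ?E t) $ i $ j) s =
        s * laplace (\<lambda>t. ?E t $ i $ j) s - (- laplace (\<lambda>t. (A ** ?E t) $ i $ j) s)"
      by simp
    also have "\<dots> = of_real (?E 0 $ i $ j)" unfolding eq by simp
    finally show ?thesis by (simp add: mat_def)
  qed
  then show ?thesis
    unfolding add_mult mlaplace_mult_left[OF E s]
    by (simp add: vec_eq_iff mat_scalar_mult_component mlaplace_def)
qed

text \<open>\<open>s M + M A = M (s + A)\<close> places \<open>M'\<close> at the right end: on the
  input side it will meet \<open>M\<close> and cancel, on the output side it stays and produces the
  two inverse factors around the observability Gramian.\<close>

lemma resolvent_eq:
  fixes A M M' :: "real^'n^'n"
  assumes E: "tame (\<lambda>t. matrix_exp (- t *\<^sub>R A))" and s: "0 < Re s" and M: "M ** M' = mat 1"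
  shows "resolvent M (M ** A) s = mlaplace (\<lambda>t. matrix_exp (- t *\<^sub>R A)) s ** cmat M'"
proof -
  let ?R = "mlaplace (\<lambda>t. matrix_exp (- t *\<^sub>R A)) s"
  have "mat s ** cmat M = cmat M ** mat s"
    by (simp add: vec_eq_iff mat_scalar_mult_component mat_scalar_mult_component_right mult.commute)
  then have fac: "mat s ** cmat M + cmat (M ** A) = cmat M ** (mat s + cmat A)"
    by (simp add: cmat_mult matrix_add_ldistrib)
  have "(cmat M ** (mat s + cmat A)) ** (?R ** cmat M') = mat 1"
  proof -
    have "(cmat M ** (mat s + cmat A)) ** (?R ** cmat M') = cmat M ** ((mat s + cmat A) ** ?R) ** cmat M'"
      by (simp only: matrix_mul_assoc)
    also have "\<dots> = cmat (M ** M')"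
      by (simp only: mlaplace_semigroup_inverse[OF E s] matrix_mul_rid cmat_mult)
    finally show ?thesis by (simp add: M cmat_mat_1)
  qed
  then show ?thesis
    unfolding resolvent_def fac by (rule matrix_inv_eqI)
qed

section \<open>Signal energies as quadratic forms of the Gramians\<close>

lemma norm_rowvector: "norm (rowvector v :: real^'n^1) = norm v"
  by (simp add: rowvector_def norm_vec_def[of "\<chi> i. _"] L2_set_def)

lemma inner_matrix_vector_transpose:
  fixes A :: "real^'n^'m"
  shows "x \<bullet> (A *v y) = (transpose A *v x) \<bullet> y"
  by (simp add: dot_lmul_matrix transpose_matrix_vector)

lemma norm_rowvector_mult_power2:
  fixes Y :: "real^'p^'n"
  shows "(norm (rowvector v ** Y :: real^'p^1))\<^sup>2 = v \<bullet> ((Y ** transpose Y) *v v)"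
proof -
  have "rowvector v ** Y = (rowvector (transpose Y *v v) :: real^'p^1)"
    by (simp add: vec_eq_iff rowvector_def matrix_matrix_mult_def matrix_vector_mult_def transpose_def mult.commute)
  then have "(norm (rowvector v ** Y :: real^'p^1))\<^sup>2 = (transpose Y *v v) \<bullet> (transpose Y *v v)"
    by (simp add: norm_rowvector power2_norm_eq_inner)
  also have "\<dots> = v \<bullet> (Y *v (transpose Y *v v))"
    by (simp add: dot_lmul_matrix[symmetric] vector_transpose_matrix inner_commute)
  finally show ?thesis by (simp only: matrix_vector_mul_assoc)
qed

lemma norm_transpose: "norm (transpose A) = norm (A :: real^'n^'m)"
proof -
  have "(norm (transpose A))\<^sup>2 = (norm A)\<^sup>2"
    unfolding norm_matrix_power2 by (simp add: transpose_def) (rule sum.swap)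
  then show ?thesis by simp
qed

lemma norm_mult_columnvector_power2:
  fixes Y :: "real^'n^'q"
  shows "(norm (Y ** columnvector v :: real^1^'q))\<^sup>2 = v \<bullet> ((transpose Y ** Y) *v v)"
proof -
  have "norm (Y ** columnvector v :: real^1^'q) = norm (rowvector v ** transpose Y :: real^'q^1)"
    by (subst norm_transpose[symmetric]) (simp add: matrix_transpose_mul transpose_columnvector)
  then show ?thesis by (simp add: norm_rowvector_mult_power2)
qed

text \<open>The map \<open>B \<mapsto> v \<bullet> (B *v v)\<close> is bounded linear and passes
  through the integral. The Lebesgue integral mediates between the Henstock-Kurzweil integral
  defining the Gramians and the nonnegative integral of the H2 norm.\<close>

lemma gramian_form:
  fixes X :: "real \<Rightarrow> real^'n^'n"
  assumes int: "set_integrable lborel {0..} X"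
    and y: "\<And>t. 0 \<le> t \<Longrightarrow> (norm (y t))\<^sup>2 = v \<bullet> (X t *v v)"
  shows "X integrable_on {0..}"
    and "0 \<le> v \<bullet> (integral {0..} X *v v)"
    and "(\<integral>\<^sup>+ t\<in>{0..}. ennreal ((norm (y t))\<^sup>2) \<partial>lborel) = ennreal (v \<bullet> (integral {0..} X *v v))"
proof -
  have bl: "bounded_linear (\<lambda>B::real^'n^'n. v \<bullet> (B *v v))"
    by (intro linear_conv_bounded_linear[THEN iffD1] linearI)
      (auto simp: matrix_vector_mult_add_rdistrib inner_add_right scaleR_matrix_vector_assoc[symmetric])
  show X: "X integrable_on {0..}"
    using set_borel_integral_eq_integral(1)[OF int] .
  have eq: "integral {0..} (\<lambda>t. v \<bullet> (X t *v v)) = v \<bullet> (integral {0..} X *v v)"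
    using integral_linear[OF X bl] by (simp add: o_def)
  have si: "set_integrable lborel {0..} (\<lambda>t. v \<bullet> (X t *v v))"
    using integrable_bounded_linear[OF bl int[unfolded set_integrable_def]]
    by (simp add: set_integrable_def linear_cmul[OF bounded_linear.linear[OF bl]])
  have nn: "0 \<le> v \<bullet> (X t *v v)" if "0 \<le> t" for t
    using y[OF that] by (metis zero_le_power2)
  show "0 \<le> v \<bullet> (integral {0..} X *v v)"
    unfolding eq[symmetric]
    by (rule Henstock_Kurzweil_Integration.integral_nonneg)
      (use set_borel_integral_eq_integral(1)[OF si] nn in auto)
  have "(\<integral>\<^sup>+ t\<in>{0..}. ennreal ((norm (y t))\<^sup>2) \<partial>lborel) =
      (\<integral>\<^sup>+ t. ennreal (indicator {0..} t *\<^sub>R (v \<bullet> (X t *v v))) \<partial>lborel)"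
    by (intro nn_integral_cong) (auto simp: indicator_def y)
  also have "\<dots> = ennreal (LINT t|lborel. indicator {0..} t *\<^sub>R (v \<bullet> (X t *v v)))"
    using si unfolding set_integrable_def
    by (rule nn_integral_eq_integral) (auto simp: indicator_def nn)
  also have "\<dots> = ennreal (v \<bullet> (integral {0..} X *v v))"
    using set_borel_integral_eq_integral(2)[OF si] by (simp add: set_lebesgue_integral_def eq)
  finally show "(\<integral>\<^sup>+ t\<in>{0..}. ennreal ((norm (y t))\<^sup>2) \<partial>lborel) = ennreal (v \<bullet> (integral {0..} X *v v))" .
qed

text \<open>One decaying factor gives an integrable bound; for the other, boundedness by
  \<open>C\<close> is enough. Transposition preserves the Frobenius norm, so \<open>gen\<close>
  covers both orders, with \<open>P\<close> and \<open>Q\<close> standing for \<open>Y\<close> and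
  its transpose.\<close>

lemma set_integrable_exp_decay_sandwich:
  fixes Y :: "real \<Rightarrow> real^'n^'n" and B :: "real^'n^'n"
  assumes r: "0 < r"
    and Y: "\<And>t. 0 \<le> t \<Longrightarrow> norm (Y t) \<le> C * exp (- r * t)"
    and cont: "\<And>t. isCont Y t"
  shows "set_integrable lborel {0..} (\<lambda>t. Y t ** B ** transpose (Y t))"
    and "set_integrable lborel {0..} (\<lambda>t. transpose (Y t) ** B ** Y t)"
proof -
  have C: "0 \<le> C" using order_trans[OF norm_ge_zero Y[of 0]] by simp
  have Tbl: "bounded_linear (transpose :: real^'n^'n \<Rightarrow> real^'n^'n)"
    by (intro linear_conv_bounded_linear[THEN iffD1] linearI) (auto simp: transpose_def vec_eq_iff)
  have gen: "set_integrable lborel {0..} (\<lambda>t. P t ** B ** Q t)"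
    if P: "\<And>t. norm (P t) = norm (Y t)" and Q: "\<And>t. norm (Q t) = norm (Y t)"
      and cP: "\<And>t. isCont P t" and cQ: "\<And>t. isCont Q t" for P Q :: "real \<Rightarrow> real^'n^'n"
  proof (rule set_integrable_bound)
    show "set_integrable lborel {0..} (\<lambda>t. C * norm B * C * exp (- r * t))"
      by (intro set_integrable_mult_right set_integrable_exp_minus_Ici r)
    have "continuous_on UNIV (\<lambda>t. P t ** B ** Q t)"
      by (intro continuous_at_imp_continuous_on ballI matrix_mult.continuous continuous_const cP cQ)
    then have [measurable]: "(\<lambda>t. P t ** B ** Q t) \<in> borel_measurable borel"
      by (rule borel_measurable_continuous_onI)
    show "set_borel_measurable lborel {0..} (\<lambda>t. P t ** B ** Q t)"
      unfolding set_borel_measurable_def by measurable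
    have "norm (P t ** B ** Q t) \<le> C * norm B * C * exp (- r * t)" if t: "0 \<le> t" for t
    proof -
      have "norm (P t ** B ** Q t) \<le> norm (P t) * norm B * norm (Q t)"
        by (meson norm_matrix_mult_le mult_right_mono norm_ge_zero order_trans)
      also have "\<dots> \<le> (C * exp (- r * t)) * norm B * C"
      proof -
        have "C * exp (- r * t) \<le> C * 1" using C r t by (intro mult_left_mono) auto
        then have "norm (Q t) \<le> C" using Y[OF t] Q by simp
        then show ?thesis
          using Y[OF t] P C by (intro mult_mono) auto
      qed
      finally show ?thesis by (simp add: mult_ac)
    qed
    then show "AE t in lborel. t \<in> {0..} \<longrightarrow> norm (P t ** B ** Q t) \<le> norm (C * norm B * C * exp (- r * t))"
      using C by (intro AE_I2) (auto simp: abs_mult)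
  qed
  have "isCont (\<lambda>t. transpose (Y t)) t" for t
    using bounded_linear.isCont[OF Tbl cont] .
  then show "set_integrable lborel {0..} (\<lambda>t. Y t ** B ** transpose (Y t))"
    and "set_integrable lborel {0..} (\<lambda>t. transpose (Y t) ** B ** Y t)"
    by (auto intro!: gen cont simp: norm_transpose)
qed

lemma diag_matrix_mult: "diag_matrix a ** diag_matrix b = (diag_matrix (\<chi> i. a $ i * b $ i) :: real^'n^'n)"
  by (simp add: vec_eq_iff matrix_matrix_mult_def diag_matrix_def if_distrib[of "\<lambda>x. x * _"] cong: if_cong)

text \<open>The explicit inverse is diagonal, hence symmetric; symmetry later moves the inverse
  across inner products.\<close>

lemma positive_diagonal_inverse:
  assumes "positive_diagonal M"
  shows "M ** matrix_inv M = mat 1" "transpose M = M" "transpose (matrix_inv M) = matrix_inv M"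
proof -
  obtain m where m: "\<And>i. 0 < m $ i" "M = diag_matrix m"
    using assms unfolding positive_diagonal_def by blast
  let ?N = "diag_matrix (\<chi> i. 1 / m $ i)"
  have "m $ i \<noteq> 0" for i using m(1)[of i] by simp
  then have inv: "M ** ?N = mat 1"
    by (simp add: m(2) diag_matrix_mult) (simp add: vec_eq_iff diag_matrix_def mat_def)
  then show "M ** matrix_inv M = mat 1" by (simp add: matrix_inv_eqI)
  have T: "transpose (diag_matrix a) = diag_matrix a" for a :: "real^'a"
    by (simp add: vec_eq_iff transpose_def diag_matrix_def)
  show "transpose M = M" "transpose (matrix_inv M) = matrix_inv M"
    unfolding matrix_inv_eqI[OF inv] by (simp_all add: m(2) T)
qed

text \<open>\<open>e_diff\<close> is polymorphic: the transfer functions contain its complex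
  instance, clusterability and the quadratic forms the real one.\<close>

lemma e_diff_cmat:
  "rowvector (e_diff i j) = cmat (rowvector (e_diff i j) :: real^'n^1)"
  "columnvector (e_diff i j) = cmat (columnvector (e_diff i j) :: real^1^'n)"
  by (simp_all add: vec_eq_iff rowvector_def columnvector_def e_diff_def axis_def)

theorem theorem6:
  fixes W M L :: "real^'n^'n" and F :: "real^'p^'n" and H :: "real^'n^'q" and i j :: 'n
  assumes "weighted_digraph W" and "weakly_connected W"
    and "positive_diagonal M" and "L = M ** laplacian W"
    and "\<exists>B. generalized_balanced B \<and> L = laplacian B"
    and "clusterable L i j"
  shows "(\<exists>J. ((\<lambda>\<tau>. matrix_exp (- \<tau> *\<^sub>R laplacian W)) \<longlongrightarrow> J) at_top) \<and>
    ctrl_integrand (laplacian W) F integrable_on {0..} \<and>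
    obs_integrand (laplacian W) H integrable_on {0..} \<and>
    h2_norm_sq (input_transfer M L F i j) < \<infinity> \<and>
    h2_norm_sq (output_transfer M L H i j) < \<infinity> \<and>
    dissimilarity M L F H i j =
      sqrt ((e_diff i j \<bullet> (ctrl_gramian (laplacian W) F *v e_diff i j)) *
            (e_diff i j \<bullet> ((matrix_inv M ** obs_gramian (laplacian W) H ** matrix_inv M) *v e_diff i j)))"
proof -
  let ?A = "laplacian W"
  let ?E = "\<lambda>t. matrix_exp (- t *\<^sub>R ?A)"
  define e :: "real^'n" where "e = e_diff i j"
  define N where "N = matrix_inv M"
  note MN = positive_diagonal_inverse[OF assms(3), folded N_def]
  have NM: "N ** M = mat 1" by (rule matrix_left_right_inverse1[OF MN(1)])
  \<comment> \<open>The column on which the semigroup acts in the output transfer function;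
    \<open>N\<close> comes from \<open>resolvent_eq\<close>.\<close>
  define f where "f = N *v e"
  obtain J C r where r: "0 < r"
    and decay: "\<And>t. 0 \<le> t \<Longrightarrow> norm (?E t - J) \<le> C * exp (- r * t)"
    and lim: "(?E \<longlongrightarrow> J) at_top" and AJ: "?A ** J = 0" and JA: "J ** ?A = 0"
    by (rule laplacian_semistable[OF assms(1)]) (rule that)
  have J: "semistable_limit ?A = J"
    unfolding semistable_limit_def by (rule tendsto_Lim[OF trivial_limit_at_top_linorder lim])
  have contE: "isCont ?E t" for t
    by (rule has_vector_derivative_continuous[OF matrix_exp_minus_has_vector_derivative])
  have tameE: "tame ?E"
  proof -
    have C: "0 \<le> C" using order_trans[OF norm_ge_zero decay[of 0]] by simp
    have "norm (?E t) \<le> norm J + C" if t: "0 \<le> t" for t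
    proof -
      have "C * exp (- r * t) \<le> C * 1" using C r t by (intro mult_left_mono) auto
      then show ?thesis using decay[OF t] norm_triangle_ineq[of J "?E t - J"] by simp
    qed
    then show ?thesis unfolding tame_def using contE by blast
  qed
  have expT: "matrix_exp (- t *\<^sub>R transpose ?A) = transpose (?E t)" for t
    by (simp only: transpose_scaleR[symmetric] matrix_exp_transpose)
  have T_diff: "transpose X - transpose Y = transpose (X - Y)" for X Y :: "real^'n^'n"
    by (simp add: transpose_def vec_eq_iff)
  have ctrl: "ctrl_integrand ?A F = (\<lambda>t. (?E t - J) ** (F ** transpose F) ** transpose (?E t - J))"
    by (rule ext) (simp only: ctrl_integrand_def J expT T_diff matrix_mul_assoc)
  have obs: "obs_integrand ?A H = (\<lambda>t. transpose (?E t - J) ** (transpose H ** H) ** (?E t - J))"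
    by (rule ext) (simp only: obs_integrand_def J expT T_diff matrix_mul_assoc)
  have T0: "transpose 0 = (0 :: real^'n^'n)"
    by (simp add: transpose_def vec_eq_iff)
  have contEJ: "isCont (\<lambda>t. ?E t - J) t" for t by (intro continuous_intros contE)
  have ctrl_int: "set_integrable lborel {0..} (ctrl_integrand ?A F)"
    unfolding ctrl by (rule set_integrable_exp_decay_sandwich(1)[OF r decay contEJ])
  have obs_int: "set_integrable lborel {0..} (obs_integrand ?A H)"
    unfolding obs by (rule set_integrable_exp_decay_sandwich(2)[OF r decay contEJ])
  \<comment> \<open>\<open>?A ** J = 0\<close> and \<open>L = M ** ?A\<close> put the range of
    \<open>J\<close> into the kernel of \<open>L\<close>, to which \<open>e\<close> is
    orthogonal.\<close>
  have eJ: "e \<bullet> (J *v x) = 0" for x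
  proof -
    have "L *v (J *v x) = 0"
      by (simp only: assms(4) matrix_vector_mul_assoc matrix_mul_assoc[symmetric] AJ matrix_mult.zero_right matrix_vector_mult_0)
    then show ?thesis
      using assms(6) by (auto simp: clusterable_def orthogonal_comp_def orthogonal_def e_def inner_commute)
  qed
  \<comment> \<open>\<open>J ** ?A = 0\<close> transposes to
    \<open>transpose L ** N ** transpose J = 0\<close>, because \<open>M\<close> is symmetric and
    \<open>M ** N = mat 1\<close>. So the range of \<open>N ** transpose J\<close> lies in the
    kernel of \<open>transpose L\<close>, and orthogonality of \<open>e\<close> to it says
    \<open>J *v (N *v e) = 0\<close>.\<close>
  have Jf: "J *v f = 0"
  proof -
    have "x \<bullet> (J *v f) = 0" for x
    proof -
      have "transpose L ** N ** transpose J = transpose (J ** ?A)"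
      proof -
        have "transpose L ** N ** transpose J = transpose ?A ** (M ** N) ** transpose J"
          by (simp only: assms(4) matrix_transpose_mul MN(2) matrix_mul_assoc)
        then show ?thesis by (simp only: MN(1) matrix_mul_rid matrix_transpose_mul)
      qed
      then have "transpose L *v (N *v (transpose J *v x)) = 0"
        by (simp only: JA T0 matrix_vector_mul_assoc matrix_mul_assoc matrix_vector_mult_0)
      then have "e \<bullet> (N *v (transpose J *v x)) = 0"
        using assms(6) by (auto simp: clusterable_def orthogonal_comp_def orthogonal_def e_def inner_commute)
      moreover have "e \<bullet> (N *v (transpose J *v x)) = x \<bullet> (J *v f)"
        by (simp only: f_def inner_matrix_vector_transpose[of e N] inner_matrix_vector_transpose[of "N *v e"]
            MN(3) transpose_transpose inner_commute)
      ultimately show ?thesis by simp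
    qed
    from this[of "J *v f"] show ?thesis by simp
  qed
  let ?u = "rowvector e :: real^'n^1"
  have uJ: "?u ** J = 0"
  proof -
    have "(?u ** J) $ a $ b = e \<bullet> (J *v axis b 1)" for a b
      by (simp add: rowvector_def matrix_matrix_mult_def matrix_vector_mult_def inner_vec_def axis_def
          if_distrib[of "\<lambda>x. _ * x"] cong: if_cong)
    then show ?thesis by (simp add: vec_eq_iff eJ)
  qed
  \<comment> \<open>Both signals are defined with the bounded \<open>?E\<close>, whose transform
    gives the resolvent, and rewritten below with the decaying \<open>?E t - J\<close>, from which
    the Gramians are built.\<close>
  define gi where "gi = (\<lambda>t. ?u ** ?E t ** F)"
  define go where "go = (\<lambda>t. H ** ?E t ** (columnvector f :: real^1^'n))"
  have gi: "(norm (gi t))\<^sup>2 = e \<bullet> (ctrl_integrand ?A F t *v e)" for t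
  proof -
    have "gi t = ?u ** ((?E t - J) ** F)"
      by (simp add: gi_def matrix_mul_assoc matrix_mult.diff_right uJ)
    then have "(norm (gi t))\<^sup>2 = e \<bullet> ((((?E t - J) ** F) ** transpose ((?E t - J) ** F)) *v e)"
      by (simp only: norm_rowvector_mult_power2)
    then show ?thesis
      by (simp only: ctrl matrix_transpose_mul matrix_mul_assoc)
  qed
  have go: "(norm (go t))\<^sup>2 = f \<bullet> (obs_integrand ?A H t *v f)" for t
  proof -
    have "J ** columnvector f = (0 :: real^1^'n)"
      unfolding dot_rowvector_columnvector[symmetric] Jf
      by (simp add: columnvector_def vec_eq_iff)
    then have "go t = (H ** (?E t - J)) ** columnvector f"
      by (simp add: go_def matrix_mul_assoc[symmetric] matrix_mult.diff_left)
    then have "(norm (go t))\<^sup>2 = f \<bullet> ((transpose (H ** (?E t - J)) ** (H ** (?E t - J))) *v f)"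
      by (simp only: norm_mult_columnvector_power2)
    then show ?thesis
      by (simp only: obs matrix_transpose_mul matrix_mul_assoc)
  qed
  have in_tr: "input_transfer M L F i j s $ a $ b = laplace (\<lambda>t. gi t $ a $ b) s" if s: "0 < Re s" for s a b
  proof -
    have "input_transfer M L F i j s = cmat ?u ** mlaplace ?E s ** cmat (N ** M) ** cmat F"
      unfolding input_transfer_def assms(4) resolvent_eq[OF tameE s MN(1)] e_diff_cmat e_def cmat_mult
      by (simp only: matrix_mul_assoc)
    also have "\<dots> = mlaplace gi s"
      by (simp only: gi_def NM cmat_mat_1 matrix_mul_rid mlaplace_mult_left[OF tameE s]
          mlaplace_mult_right[OF tame_matrix_mult_left[OF tameE] s])
    finally show ?thesis by (simp add: mlaplace_def)
  qed
  have out_tr: "output_transfer M L H i j s $ a $ b = laplace (\<lambda>t. go t $ a $ b) s" if s: "0 < Re s" for s a b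
  proof -
    have "output_transfer M L H i j s = cmat H ** mlaplace ?E s ** cmat (N ** columnvector e)"
      unfolding output_transfer_def assms(4) resolvent_eq[OF tameE s MN(1)] e_diff_cmat e_def cmat_mult
      by (simp only: matrix_mul_assoc)
    also have "\<dots> = mlaplace go s"
      by (simp only: go_def f_def dot_rowvector_columnvector mlaplace_mult_left[OF tameE s]
          mlaplace_mult_right[OF tame_matrix_mult_left[OF tameE] s])
    finally show ?thesis by (simp add: mlaplace_def)
  qed
  have tgi: "tame gi" and tgo: "tame go"
    unfolding gi_def go_def by (intro tame_matrix_mult_left tame_matrix_mult_right tameE)+
  note ctrl_form = gramian_form[OF ctrl_int gi, folded ctrl_gramian_def]
  note obs_form = gramian_form[OF obs_int go, folded obs_gramian_def]
  have h_in: "h2_norm_sq (input_transfer M L F i j) = ennreal (e \<bullet> (ctrl_gramian ?A F *v e))"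
    using h2_norm_sq_laplace[OF tgi in_tr] ctrl_form(3) by simp
  have h_out: "h2_norm_sq (output_transfer M L H i j) = ennreal (f \<bullet> (obs_gramian ?A H *v f))"
    using h2_norm_sq_laplace[OF tgo out_tr] obs_form(3) by simp
  have "f \<bullet> (obs_gramian ?A H *v f) = e \<bullet> ((N ** obs_gramian ?A H ** N) *v e)"
  proof -
    have "f \<bullet> y = e \<bullet> (N *v y)" for y
      by (simp only: f_def inner_matrix_vector_transpose[of e N] MN(3))
    then show ?thesis
      by (simp only: f_def matrix_vector_mul_assoc matrix_mul_assoc)
  qed
  \<comment> \<open>Nonnegativity of both quadratic forms lets \<open>enn2real\<close> return them
    unchanged.\<close>
  then have "dissimilarity M L F H i j = sqrt ((e \<bullet> (ctrl_gramian ?A F *v e)) * (e \<bullet> ((N ** obs_gramian ?A H ** N) *v e)))"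
    unfolding dissimilarity_def h2_norm_def h_in h_out
    using ctrl_form(2) obs_form(2) by (simp add: real_sqrt_mult)
  then show ?thesis
    using lim ctrl_form(1) obs_form(1) h_in h_out by (auto simp: e_def N_def)
qed

end
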